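(* (In $\mathsf{ZF}$.) For the additive group $(\mathbb{R},+)$, $\mathbb{R}\not\to(\mathrm{uncountable})^{\operatorname{FS}}_{2}$. That is, there exists a colouring $d:\mathbb{R}\to 2$ such that there is no uncountable set $X\subseteq\mathbb{R}$ for which $\operatorname{FS}(X)$ is $d$-monochromatic.
   Context: The base theory is $\mathsf{ZF}$ (no form of the Axiom of Choice is assumed). For $X\subseteq\mathbb{R}$, $\operatorname{FS}(X)=\{\sum_{a\in F}a : F\subseteq X \text{ finite and nonempty}\}$. A set is $d$-monochromatic if $d$ is constant on it. A set is uncountable if it does not inject into $\omega$. *)

theory Defs
  imports "HOL-Algebra.Ring"
begin

text \<open>
  HOL proves the Axiom of Choice, so a statement about the HOL type \<open>real\<close> would not express a
  theorem of ZF. Being a theorem of ZF is therefore rendered as truth in every model of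
  first-order ZF (equivalent by the completeness theorem).

  A structure for the language of set theory is a type \<open>'m\<close> with a binary relation \<open>E\<close>
  (\<open>E x y\<close>: ``\<open>x\<close> is a member of \<open>y\<close>''). Sets, functions and subsets of the structure are
  elements of \<open>'m\<close>; values of type \<open>'m set\<close> below play the role of classes of the structure, and
  are only ever given by first-order conditions. Apart from the variable assignments \<open>v\<close> in the
  axiom schemata, of which a formula uses only finitely many values, nothing below quantifies over HOL
  sets or HOL functions: that would reintroduce the choice principles of HOL.
\<close>

section \<open>Models of ZF\<close>

datatype fm = FMem nat nat | FEq nat nat | FNot fm | FAnd fm fm | FEx nat fm

primrec sat :: "('m \<Rightarrow> 'm \<Rightarrow> bool) \<Rightarrow> (nat \<Rightarrow> 'm) \<Rightarrow> fm \<Rightarrow> bool" where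
  "sat E v (FMem i j) \<longleftrightarrow> E (v i) (v j)"
| "sat E v (FEq i j) \<longleftrightarrow> v i = v j"
| "sat E v (FNot p) \<longleftrightarrow> \<not> sat E v p"
| "sat E v (FAnd p q) \<longleftrightarrow> sat E v p \<and> sat E v q"
| "sat E v (FEx i p) \<longleftrightarrow> (\<exists>x. sat E (v(i := x)) p)"

definition elts :: "('m \<Rightarrow> 'm \<Rightarrow> bool) \<Rightarrow> 'm \<Rightarrow> 'm set" where
  "elts E x = {z. E z x}"

definition inductive_in :: "('m \<Rightarrow> 'm \<Rightarrow> bool) \<Rightarrow> 'm \<Rightarrow> bool" where
  "inductive_in E w \<longleftrightarrow> (\<exists>z\<in>elts E w. elts E z = {}) \<and>
     (\<forall>x\<in>elts E w. \<exists>y\<in>elts E w. elts E y = insert x (elts E x))"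

text \<open>
  In order: extensionality, foundation, pairing, union, power set, infinity, and the schemata of
  separation and replacement, in which the values of \<open>v\<close> at variables other than \<open>0\<close> (and \<open>1\<close> for
  replacement) are the parameters.
\<close>

definition ZF :: "('m \<Rightarrow> 'm \<Rightarrow> bool) \<Rightarrow> bool" where
  "ZF E \<longleftrightarrow>
     (\<forall>x y. elts E x = elts E y \<longrightarrow> x = y) \<and>
     (\<forall>x. elts E x \<noteq> {} \<longrightarrow> (\<exists>y\<in>elts E x. elts E y \<inter> elts E x = {})) \<and>
     (\<forall>x y. \<exists>z. elts E z = {x, y}) \<and>
     (\<forall>x. \<exists>u. elts E u = (\<Union>y\<in>elts E x. elts E y)) \<and>
     (\<forall>x. \<exists>p. elts E p = {z. elts E z \<subseteq> elts E x}) \<and>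
     (\<exists>w. inductive_in E w) \<and>
     (\<forall>\<phi> v x. \<exists>y. elts E y = {z \<in> elts E x. sat E (v(0 := z)) \<phi>}) \<and>
     (\<forall>\<phi> v a.
        (\<forall>x\<in>elts E a. \<forall>y y'. sat E (v(0 := x, 1 := y)) \<phi> \<longrightarrow> sat E (v(0 := x, 1 := y')) \<phi> \<longrightarrow> y = y')
        \<longrightarrow> (\<exists>b. elts E b = {y. \<exists>x\<in>elts E a. sat E (v(0 := x, 1 := y)) \<phi>}))"


section \<open>Set-theoretic notions inside a model\<close>

text \<open>
  In a model of ZF the descriptions below denote uniquely determined elements (\<open>app_in E f x\<close> provided
  \<open>f\<close> is a function of the model with \<open>x\<close> in its domain).
\<close>

definition empty_in :: "('m \<Rightarrow> 'm \<Rightarrow> bool) \<Rightarrow> 'm" where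
  "empty_in E = (THE z. elts E z = {})"

definition succ_in :: "('m \<Rightarrow> 'm \<Rightarrow> bool) \<Rightarrow> 'm \<Rightarrow> 'm" where
  "succ_in E x = (THE y. elts E y = insert x (elts E x))"

definition omega_in :: "('m \<Rightarrow> 'm \<Rightarrow> bool) \<Rightarrow> 'm set" where
  "omega_in E = {n. \<forall>w. inductive_in E w \<longrightarrow> n \<in> elts E w}"

definition two_in :: "('m \<Rightarrow> 'm \<Rightarrow> bool) \<Rightarrow> 'm set" where
  "two_in E = {empty_in E, succ_in E (empty_in E)}"

definition is_pair :: "('m \<Rightarrow> 'm \<Rightarrow> bool) \<Rightarrow> 'm \<Rightarrow> 'm \<Rightarrow> 'm \<Rightarrow> bool" where
  "is_pair E x y p \<longleftrightarrow> (\<exists>a b. elts E a = {x} \<and> elts E b = {x, y} \<and> elts E p = {a, b})"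

definition pair_in :: "('m \<Rightarrow> 'm \<Rightarrow> bool) \<Rightarrow> 'm \<Rightarrow> 'm \<Rightarrow> 'm" where
  "pair_in E x y = (THE p. is_pair E x y p)"

definition times_in :: "('m \<Rightarrow> 'm \<Rightarrow> bool) \<Rightarrow> 'm set \<Rightarrow> 'm set \<Rightarrow> 'm set" where
  "times_in E A B = {p. \<exists>x\<in>A. \<exists>y\<in>B. is_pair E x y p}"

definition rel_in :: "('m \<Rightarrow> 'm \<Rightarrow> bool) \<Rightarrow> 'm \<Rightarrow> 'm \<Rightarrow> 'm \<Rightarrow> bool" where
  "rel_in E r x y \<longleftrightarrow> (\<exists>p\<in>elts E r. is_pair E x y p)"

definition function_in :: "('m \<Rightarrow> 'm \<Rightarrow> bool) \<Rightarrow> 'm \<Rightarrow> 'm set \<Rightarrow> 'm set \<Rightarrow> bool" where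
  "function_in E f A B \<longleftrightarrow> elts E f \<subseteq> times_in E A B \<and> (\<forall>x\<in>A. \<exists>!y. rel_in E f x y)"

definition app_in :: "('m \<Rightarrow> 'm \<Rightarrow> bool) \<Rightarrow> 'm \<Rightarrow> 'm \<Rightarrow> 'm" where
  "app_in E f x = (THE y. rel_in E f x y)"

definition uncountable_in :: "('m \<Rightarrow> 'm \<Rightarrow> bool) \<Rightarrow> 'm \<Rightarrow> bool" where
  "uncountable_in E X \<longleftrightarrow>
     \<not> (\<exists>f. function_in E f (elts E X) (omega_in E) \<and> inj_on (app_in E f) (elts E X))"


section \<open>The real numbers of a model\<close>

abbreviation op_in :: "('m \<Rightarrow> 'm \<Rightarrow> bool) \<Rightarrow> 'm \<Rightarrow> 'm \<Rightarrow> 'm \<Rightarrow> 'm" where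
  "op_in E f x y \<equiv> app_in E f (pair_in E x y)"

definition ring_in :: "('m \<Rightarrow> 'm \<Rightarrow> bool) \<Rightarrow> 'm \<Rightarrow> 'm \<Rightarrow> 'm \<Rightarrow> 'm \<Rightarrow> 'm \<Rightarrow> 'm ring" where
  "ring_in E R radd rmul z u =
     \<lparr>carrier = elts E R, monoid.mult = op_in E rmul, one = u, zero = z, add = op_in E radd\<rparr>"

text \<open>
  \<open>(R, radd, rmul, rle, z, u)\<close> is, in the sense of the model, a Dedekind-complete ordered field with
  zero \<open>z\<close> and unit \<open>u\<close>; ZF proves that such a field exists and is unique up to a unique isomorphism.
  Completeness concerns only those subsets of \<open>R\<close> that are elements of the model. The field axioms
  are first-order over the carrier, so the external \<open>field\<close> predicate agrees with the internal one.
\<close>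

definition reals_in ::
    "('m \<Rightarrow> 'm \<Rightarrow> bool) \<Rightarrow> 'm \<Rightarrow> 'm \<Rightarrow> 'm \<Rightarrow> 'm \<Rightarrow> 'm \<Rightarrow> 'm \<Rightarrow> bool" where
  "reals_in E R radd rmul rle z u \<longleftrightarrow>
     function_in E radd (times_in E (elts E R) (elts E R)) (elts E R) \<and>
     function_in E rmul (times_in E (elts E R) (elts E R)) (elts E R) \<and>
     field (ring_in E R radd rmul z u) \<and>
     elts E rle \<subseteq> times_in E (elts E R) (elts E R) \<and>
     linear_order_on (elts E R) {(x, y). rel_in E rle x y} \<and>
     (\<forall>x\<in>elts E R. \<forall>y\<in>elts E R. \<forall>w\<in>elts E R.
        rel_in E rle x y \<longrightarrow> rel_in E rle (op_in E radd x w) (op_in E radd y w)) \<and>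
     (\<forall>x\<in>elts E R. \<forall>y\<in>elts E R.
        rel_in E rle z x \<longrightarrow> rel_in E rle z y \<longrightarrow> rel_in E rle z (op_in E rmul x y)) \<and>
     (\<forall>S. elts E S \<subseteq> elts E R \<longrightarrow> elts E S \<noteq> {} \<longrightarrow>
        (\<exists>b\<in>elts E R. \<forall>s\<in>elts E S. rel_in E rle s b) \<longrightarrow>
        (\<exists>b\<in>elts E R. (\<forall>s\<in>elts E S. rel_in E rle s b) \<and>
           (\<forall>c\<in>elts E R. (\<forall>s\<in>elts E S. rel_in E rle s c) \<longrightarrow> rel_in E rle b c)))"


section \<open>Finite sums\<close>

text \<open>
  \<open>F\<close> is finite in the model and \<open>s\<close> is the sum of its elements: \<open>f\<close> is a bijection from a natural
  number \<open>n\<close> of the model onto \<open>F\<close>, and \<open>g\<close> is the sequence of partial sums along \<open>f\<close>.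
\<close>

definition finite_sum_in ::
    "('m \<Rightarrow> 'm \<Rightarrow> bool) \<Rightarrow> 'm \<Rightarrow> 'm \<Rightarrow> 'm \<Rightarrow> 'm \<Rightarrow> 'm \<Rightarrow> bool" where
  "finite_sum_in E R radd z F s \<longleftrightarrow>
     (\<exists>n\<in>omega_in E. \<exists>f g.
        function_in E f (elts E n) (elts E F) \<and>
        bij_betw (app_in E f) (elts E n) (elts E F) \<and>
        function_in E g (elts E (succ_in E n)) (elts E R) \<and>
        app_in E g (empty_in E) = z \<and>
        (\<forall>k\<in>elts E n. app_in E g (succ_in E k) = op_in E radd (app_in E g k) (app_in E f k)) \<and>
        app_in E g n = s)"

definition FS_in ::
    "('m \<Rightarrow> 'm \<Rightarrow> bool) \<Rightarrow> 'm \<Rightarrow> 'm \<Rightarrow> 'm \<Rightarrow> 'm \<Rightarrow> 'm set" where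
  "FS_in E R radd z X =
     {s. \<exists>F. elts E F \<subseteq> elts E X \<and> elts E F \<noteq> {} \<and> finite_sum_in E R radd z F s}"

definition monochromatic_in :: "('m \<Rightarrow> 'm \<Rightarrow> bool) \<Rightarrow> 'm \<Rightarrow> 'm set \<Rightarrow> bool" where
  "monochromatic_in E d A \<longleftrightarrow> (\<exists>c. \<forall>s\<in>A. app_in E d s = c)"

end

theory Submission
  imports Defs
begin

text \<open>
  Colour a real number by the position of its absolute value between powers of 4: every positive \<open>x\<close>
  lies in exactly one cell \<open>[p, 4 p)\<close> with \<open>p\<close> an integer power of 4, and its colour says whether it lies in
  the half \<open>[p, 2 p)\<close> or in the half \<open>[2 p, 4 p)\<close>. If two numbers lie in the same half of a cell, their
  sum lies in the next half, which has the other colour (\<open>low_sum\<close>). Hence if the sums of at most two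
  distinct elements of \<open>X\<close> all have the same colour, \<open>X\<close> has at most one element in each cell and at most
  one in each opposite \<open>(-4 p, -p]\<close> of a cell (\<open>coloured_sum\<close>). Labelling the elements of \<open>X\<close> by their
  cells injects \<open>X\<close> into the set formed by 0 and the powers of 4 with both signs, and this set is
  countable. No choice is involved: the colouring and the labelling are explicit.

  Inside a model this requires every set and function of the argument to be an element of the model,
  that is, to be obtained from separation or replacement by a first-order formula. The work of writing
  formulas is taken over by the closure properties of \<open>definable\<close>. Two constructions need recursion.
  The powers of 4 are the least set that contains 1 and is closed under a map (\<open>reflect\<close>) that alternates
  between exponents of both signs; induction over this set for definable properties shows that its members
  are spaced by a factor 4 (\<open>not_near\<close>), and completeness of the reals, for sets of the model, shows that the cells
  cover the positive reals (\<open>cell_exists\<close>). Countability of the set of labels is the isomorphism of Peano structures: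
  an orbit of an injective definable map starting outside the image of the map is isomorphic to \<open>\<omega>\<close>
  inside the model (\<open>orbit_countable\<close>).
\<close>

section \<open>Definability with parameters\<close>

text \<open>
  What makes fresh variables available in the renaming lemma below.
\<close>

lemma sat_depends_on_finitely_many:
  "\<exists>N. \<forall>v v'. (\<forall>i<N. v i = v' i) \<longrightarrow> sat E v \<phi> = sat E v' \<phi>"
proof (induction \<phi>)
  case (FMem i j)
  show ?case by (rule exI[of _ "Suc (max i j)"]) auto
next
  case (FEq i j)
  show ?case by (rule exI[of _ "Suc (max i j)"]) auto
next
  case (FNot p)
  then show ?case by simp
next
  case (FAnd p q)
  then obtain M N where
    M: "\<And>v v'. (\<forall>i<M. v i = v' i) \<Longrightarrow> sat E v p = sat E v' p" and
    N: "\<And>v v'. (\<forall>i<N. v i = v' i) \<Longrightarrow> sat E v q = sat E v' q"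
    by blast
  have "sat E v (FAnd p q) = sat E v' (FAnd p q)" if "\<forall>i<max M N. v i = v' i" for v v'
  proof -
    have "sat E v p = sat E v' p" by (rule M) (use that in simp)
    moreover have "sat E v q = sat E v' q" by (rule N) (use that in simp)
    ultimately show ?thesis by simp
  qed
  then show ?case by blast
next
  case (FEx k p)
  then obtain N where N: "\<And>v v'. (\<forall>i<N. v i = v' i) \<Longrightarrow> sat E v p = sat E v' p" by blast
  have "sat E (v(k := x)) p = sat E (v'(k := x)) p" if "\<forall>i<N. v i = v' i" for v v' x
    by (rule N) (use that in simp)
  then have "sat E v (FEx k p) = sat E v' (FEx k p)" if "\<forall>i<N. v i = v' i" for v v'
    unfolding sat.simps using that by blast
  then show ?case by blast
qed

text \<open>
  Formulas carry named bound variables, so a binder may capture a renamed variable; each bound variable is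
  therefore replaced by one outside the range of the renaming on the variables that matter.
\<close>

lemma sat_rename: "\<exists>\<psi>. \<forall>v. sat E v \<psi> = sat E (\<lambda>i. v (r i)) \<phi>"
proof (induction \<phi> arbitrary: r)
  case (FMem i j)
  show ?case by (rule exI[of _ "FMem (r i) (r j)"]) simp
next
  case (FEq i j)
  show ?case by (rule exI[of _ "FEq (r i) (r j)"]) simp
next
  case (FNot p)
  then obtain \<psi> where "\<forall>v. sat E v \<psi> = sat E (\<lambda>i. v (r i)) p" by blast
  then show ?case by (intro exI[of _ "FNot \<psi>"]) simp
next
  case (FAnd p q)
  obtain \<psi> where "\<forall>v. sat E v \<psi> = sat E (\<lambda>i. v (r i)) p" using FAnd(1) by blast
  moreover obtain \<chi> where "\<forall>v. sat E v \<chi> = sat E (\<lambda>i. v (r i)) q" using FAnd(2) by blast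
  ultimately show ?case by (intro exI[of _ "FAnd \<psi> \<chi>"]) simp
next
  case (FEx k p)
  obtain N where N: "\<And>v v'. (\<forall>i<N. v i = v' i) \<Longrightarrow> sat E v p = sat E v' p"
    using sat_depends_on_finitely_many[of E p] by blast
  obtain m where m: "m \<notin> r ` {..<N}"
    using ex_new_if_finite[of "r ` {..<N}"] infinite_UNIV_nat by blast
  obtain \<psi> where \<psi>: "\<And>v. sat E v \<psi> = sat E (\<lambda>i. v ((r(k := m)) i)) p"
    using FEx[of "r(k := m)"] by blast
  have "sat E (v(m := x)) \<psi> = sat E ((\<lambda>i. v (r i))(k := x)) p" for v x
    unfolding \<psi> by (rule N) (use m in auto)
  then show ?case by (intro exI[of _ "FEx m \<psi>"]) simp
qed

text \<open>
  A variable of a formula stands either for a parameter, an element of the structure fixed once and for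
  all, or for one of the arguments \<open>v j\<close>. Keeping the parameters apart from the arguments lets two formulas
  with different parameters be combined.
\<close>

definition valuation :: "(nat \<Rightarrow> 'm + nat) \<Rightarrow> (nat \<Rightarrow> 'm) \<Rightarrow> nat \<Rightarrow> 'm" where
  "valuation t v i = (case t i of Inl c \<Rightarrow> c | Inr j \<Rightarrow> v j)"

text \<open>
  First-order definability with parameters of a property of an assignment. A property of one or two
  elements is handled as \<open>\<lambda>v. P (v 0)\<close> or \<open>\<lambda>v. P (v 0) (v 1)\<close>; the arguments form a stack on which
  quantifiers push a new entry \<open>v 0\<close>. The closure rules collected under the name \<open>definable\<close> mirror the
  syntax of HOL formulas, so that definability of a concrete property is proved by \<open>intro definable\<close>.
\<close>

definition definable :: "('m \<Rightarrow> 'm \<Rightarrow> bool) \<Rightarrow> ((nat \<Rightarrow> 'm) \<Rightarrow> bool) \<Rightarrow> bool" where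
  "definable E P \<longleftrightarrow> (\<exists>\<phi> t. \<forall>v. P v = sat E (valuation t v) \<phi>)"

text \<open>
  A function of the assignment is definable if its graph is, the value being the entry \<open>v 0\<close> pushed on
  top of the arguments.
\<close>

definition definable_term :: "('m \<Rightarrow> 'm \<Rightarrow> bool) \<Rightarrow> ((nat \<Rightarrow> 'm) \<Rightarrow> 'm) \<Rightarrow> bool" where
  "definable_term E f \<longleftrightarrow> definable E (\<lambda>v. v 0 = f (\<lambda>i. v (Suc i)))"

named_theorems definable

lemma definable_rename:
  assumes "definable E P"
  shows "definable E (\<lambda>v. P (\<lambda>i. v (r i)))"
proof -
  obtain \<phi> t where \<phi>: "\<And>v. P v = sat E (valuation t v) \<phi>"
    using assms unfolding definable_def by blast
  have "valuation (\<lambda>i. map_sum id r (t i)) v = valuation t (\<lambda>i. v (r i))" for v :: "nat \<Rightarrow> 'a"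
    by (rule ext) (simp add: valuation_def split: sum.split)
  then have "P (\<lambda>i. v (r i)) = sat E (valuation (\<lambda>i. map_sum id r (t i)) v) \<phi>" for v
    by (simp only: \<phi>)
  then show ?thesis unfolding definable_def by blast
qed

lemma definable_mem_var: "definable E (\<lambda>v. E (v i) (v j))"
  unfolding definable_def
  by (intro exI[of _ "FMem i j"] exI[of _ Inr]) (simp add: valuation_def)

lemma definable_eq_var: "definable E (\<lambda>v. v i = v j)"
  unfolding definable_def
  by (intro exI[of _ "FEq i j"] exI[of _ Inr]) (simp add: valuation_def)

lemma definable_eq_param: "definable E (\<lambda>v. v i = c)"
  unfolding definable_def
  by (intro exI[of _ "FEq 0 1"] exI[of _ "\<lambda>k. if k = 0 then Inr i else Inl c"])
     (simp add: valuation_def)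

lemma definable_not [definable]:
  assumes "definable E P"
  shows "definable E (\<lambda>v. \<not> P v)"
proof -
  obtain \<phi> t where "\<And>v. P v = sat E (valuation t v) \<phi>"
    using assms unfolding definable_def by blast
  then have "(\<not> P v) = sat E (valuation t v) (FNot \<phi>)" for v by simp
  then show ?thesis unfolding definable_def by blast
qed

lemma definable_and [definable]:
  assumes "definable E P" "definable E Q"
  shows "definable E (\<lambda>v. P v \<and> Q v)"
proof -
  obtain \<phi> s where \<phi>: "\<And>v. P v = sat E (valuation s v) \<phi>"
    using assms(1) unfolding definable_def by blast
  obtain \<psi> t where \<psi>: "\<And>v. Q v = sat E (valuation t v) \<psi>"
    using assms(2) unfolding definable_def by blast
  obtain \<phi>' where \<phi>': "\<And>v. sat E v \<phi>' = sat E (\<lambda>i. v (2 * i)) \<phi>"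
    using sat_rename[of E "\<lambda>i. 2 * i"] by blast
  obtain \<psi>' where \<psi>': "\<And>v. sat E v \<psi>' = sat E (\<lambda>i. v (2 * i + 1)) \<psi>"
    using sat_rename[of E "\<lambda>i. 2 * i + 1"] by blast
  \<comment> \<open>The two formulas get the even and the odd variables.\<close>
  define st where "st i = (if even i then s (i div 2) else t (i div 2))" for i
  have "(\<lambda>i. valuation st v (2 * i)) = valuation s v"
       "(\<lambda>i. valuation st v (2 * i + 1)) = valuation t v" for v
    by (simp_all add: valuation_def st_def fun_eq_iff)
  then have "(P v \<and> Q v) = sat E (valuation st v) (FAnd \<phi>' \<psi>')" for v
    by (simp only: sat.simps \<phi> \<psi> \<phi>' \<psi>')
  then show ?thesis unfolding definable_def by blast
qed

lemma definable_ex [definable]: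
  assumes "definable E (\<lambda>v. P (v 0) (\<lambda>i. v (Suc i)))"
  shows "definable E (\<lambda>v. \<exists>x. P x v)"
proof -
  obtain \<phi> t where \<phi>: "\<And>v. P (v 0) (\<lambda>i. v (Suc i)) = sat E (valuation t v) \<phi>"
    using assms unfolding definable_def by blast
  \<comment> \<open>All variables that stand for the pushed argument are merged into variable 0, which is then
    quantified; the others are moved out of its way.\<close>
  define r where "r i = (if t i = Inr 0 then 0 else Suc i)" for i
  define s where "s k = (case k of 0 \<Rightarrow> Inr 0 | Suc i \<Rightarrow>
      (case t i of Inl c \<Rightarrow> Inl c | Inr j \<Rightarrow> Inr (j - 1)))" for k
  obtain \<psi> where \<psi>: "\<And>v. sat E v \<psi> = sat E (\<lambda>i. v (r i)) \<phi>"
    using sat_rename[of E r] by blast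
  have "P x v = sat E ((valuation s v)(0 := x)) \<psi>" for x v
  proof -
    define v' where "v' k = (case k of 0 \<Rightarrow> x | Suc i \<Rightarrow> v i)" for k
    have "P x v = P (v' 0) (\<lambda>i. v' (Suc i))" by (simp add: v'_def)
    also have "\<dots> = sat E (valuation t v') \<phi>" by (rule \<phi>)
    also have "valuation t v' = (\<lambda>i. ((valuation s v)(0 := x)) (r i))"
      by (rule ext) (auto simp: valuation_def r_def s_def v'_def split: sum.split nat.split)
    finally show ?thesis by (simp only: \<psi>)
  qed
  then have "(\<exists>x. P x v) = sat E (valuation s v) (FEx 0 \<psi>)" for v by simp
  then show ?thesis unfolding definable_def by blast
qed

lemma definable_or [definable]:
  "definable E P \<Longrightarrow> definable E Q \<Longrightarrow> definable E (\<lambda>v. P v \<or> Q v)"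
  using definable_not[OF definable_and[OF definable_not definable_not], of E P Q] by simp

lemma definable_imp [definable]:
  "definable E P \<Longrightarrow> definable E Q \<Longrightarrow> definable E (\<lambda>v. P v \<longrightarrow> Q v)"
  unfolding imp_conv_disj by (intro definable_or definable_not)

lemma definable_iff [definable]:
  "definable E P \<Longrightarrow> definable E Q \<Longrightarrow> definable E (\<lambda>v. P v \<longleftrightarrow> Q v)"
  unfolding iff_conv_conj_imp by (intro definable_and definable_imp)

lemma definable_all [definable]:
  "definable E (\<lambda>v. P (v 0) (\<lambda>i. v (Suc i))) \<Longrightarrow> definable E (\<lambda>v. \<forall>x. P x v)"
  using definable_not[OF definable_ex[where P = "\<lambda>x v. \<not> P x v", OF definable_not]] by simp

text \<open>
  Substituting a definable function is a bounded use of the existential quantifier: \<open>P (a v) v\<close> holds iff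
  some \<open>x\<close> with \<open>x = a v\<close> satisfies \<open>P x v\<close>.
\<close>

lemma definable_substitution:
  assumes "definable_term E a" "definable E (\<lambda>v. P (v 0) (\<lambda>i. v (Suc i)))"
  shows "definable E (\<lambda>v. P (a v) v)"
proof -
  have "definable E (\<lambda>v. \<exists>x. x = a v \<and> P x v)"
    using assms by (intro definable_ex definable_and) (simp_all add: definable_term_def)
  then show ?thesis by simp
qed

lemma definable_term_rename:
  assumes "definable_term E a"
  shows "definable_term E (\<lambda>v. a (\<lambda>i. v (r i)))"
  using definable_rename[OF assms[unfolded definable_term_def], of "case_nat 0 (\<lambda>i. Suc (r i))"]
  by (simp add: definable_term_def)

lemma definable_rel1:
  assumes "definable E (\<lambda>v. P (v 0))" "definable_term E a"
  shows "definable E (\<lambda>v. P (a v))"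
  by (rule definable_substitution[OF assms(2)]) (rule assms(1))

lemma definable_rel2:
  assumes P: "definable E (\<lambda>v. P (v 0) (v 1))"
    and a: "definable_term E a" and b: "definable_term E b"
  shows "definable E (\<lambda>v. P (a v) (b v))"
proof (rule definable_substitution[OF a], rule definable_substitution)
  show "definable_term E (\<lambda>v. b (\<lambda>i. v (Suc i)))" by (rule definable_term_rename[OF b])
  show "definable E (\<lambda>v. P (v (Suc 0)) (v 0))"
    using definable_rename[OF P, of "\<lambda>i. if i = 0 then 1 else 0"] by simp
qed

lemma definable_rel3:
  assumes P: "definable E (\<lambda>v. P (v 0) (v 1) (v 2))"
    and a: "definable_term E a" and b: "definable_term E b" and c: "definable_term E c"
  shows "definable E (\<lambda>v. P (a v) (b v) (c v))"
proof -
  have "definable E (\<lambda>v. P (v (Suc (Suc 0))) (v (Suc 0)) (v 0))"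
    using definable_rename[OF P, of "\<lambda>i. 2 - i"] by (simp add: numeral_2_eq_2)
  then have "definable E (\<lambda>v. P (v (Suc 0)) (v 0) (c (\<lambda>i. v (Suc (Suc i)))))"
    by (intro definable_substitution[where P = "\<lambda>z v. P (v (Suc 0)) (v 0) z"]
          definable_term_rename[OF c])
  then have "definable E (\<lambda>v. P (v 0) (b (\<lambda>i. v (Suc i))) (c (\<lambda>i. v (Suc i))))"
    by (intro definable_substitution[where P = "\<lambda>y v. P (v 0) y (c (\<lambda>i. v (Suc i)))"]
          definable_term_rename[OF b])
  then show ?thesis by (rule definable_substitution[where P = "\<lambda>x v. P x (b v) (c v)", OF a])
qed

lemma definable_term_var [definable]: "definable_term E (\<lambda>v. v i)"
  unfolding definable_term_def by (rule definable_eq_var)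

lemma definable_term_param [definable]: "definable_term E (\<lambda>v. c)"
  unfolding definable_term_def by (rule definable_eq_param)

lemma definable_term1:
  assumes f: "definable E (\<lambda>v. v 0 = f (v 1))" and a: "definable_term E a"
  shows "definable_term E (\<lambda>v. f (a v))"
  unfolding definable_term_def
  by (rule definable_rel2[where P = "\<lambda>y x. y = f x"])
     (use f in simp, rule definable, rule definable_term_rename[OF a])

lemma definable_term2:
  assumes f: "definable E (\<lambda>v. v 0 = f (v 1) (v 2))"
    and a: "definable_term E a" and b: "definable_term E b"
  shows "definable_term E (\<lambda>v. f (a v) (b v))"
  unfolding definable_term_def
  by (rule definable_rel3[where P = "\<lambda>z x y. z = f x y"])
     (use f in simp, rule definable, rule definable_term_rename[OF a], rule definable_term_rename[OF b])

lemma definable_mem [definable]: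
  "definable_term E a \<Longrightarrow> definable_term E b \<Longrightarrow> definable E (\<lambda>v. E (a v) (b v))"
  by (rule definable_rel2[where P = E]) (rule definable_mem_var)

lemma definable_eq [definable]:
  "definable_term E a \<Longrightarrow> definable_term E b \<Longrightarrow> definable E (\<lambda>v. a v = b v)"
  by (rule definable_rel2[where P = "(=)"]) (rule definable_eq_var)

lemma definable_elts [definable]:
  "definable_term E a \<Longrightarrow> definable_term E b \<Longrightarrow> definable E (\<lambda>v. a v \<in> elts E (b v))"
  by (simp add: elts_def definable_mem)

lemma definable_elts_all [definable]:
  assumes "definable_term E a" "definable E (\<lambda>v. P (v 0) (\<lambda>i. v (Suc i)))"
  shows "definable E (\<lambda>v. \<forall>x \<in> elts E (a v). P x v)"
  unfolding Ball_def
  by (intro definable_all definable_imp definable_elts definable_term_var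
        definable_term_rename[OF assms(1)] assms(2))

lemma definable_elts_ex [definable]:
  assumes "definable_term E a" "definable E (\<lambda>v. P (v 0) (\<lambda>i. v (Suc i)))"
  shows "definable E (\<lambda>v. \<exists>x \<in> elts E (a v). P x v)"
  unfolding Bex_def
  by (intro definable_ex definable_and definable_elts definable_term_var
        definable_term_rename[OF assms(1)] assms(2))

lemma definable_term_if [definable]:
  assumes "definable E P" "definable_term E a" "definable_term E b"
  shows "definable_term E (\<lambda>v. if P v then a v else b v)"
proof -
  have "definable E (\<lambda>v. (P (\<lambda>i. v (Suc i)) \<and> v 0 = a (\<lambda>i. v (Suc i))) \<or>
                         (\<not> P (\<lambda>i. v (Suc i)) \<and> v 0 = b (\<lambda>i. v (Suc i))))"
    by (intro definable_or definable_and definable_not definable_rename[OF assms(1)]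
          assms(2,3)[unfolded definable_term_def])
  moreover have "(v 0 = (if P (\<lambda>i. v (Suc i)) then a (\<lambda>i. v (Suc i)) else b (\<lambda>i. v (Suc i)))) \<longleftrightarrow>
      (P (\<lambda>i. v (Suc i)) \<and> v 0 = a (\<lambda>i. v (Suc i))) \<or>
      (\<not> P (\<lambda>i. v (Suc i)) \<and> v 0 = b (\<lambda>i. v (Suc i)))" for v
    by simp
  ultimately show ?thesis unfolding definable_term_def by simp
qed

lemma definable_ex1 [definable]:
  assumes "definable E (\<lambda>v. P (v 0) (\<lambda>i. v (Suc i)))"
  shows "definable E (\<lambda>v. \<exists>!x. P x v)"
proof -
  have "definable E (\<lambda>v. P (v 0) (\<lambda>i. v (Suc (Suc i))))"
    using definable_rename[OF assms, of "case_nat 0 (\<lambda>i. Suc (Suc i))"] by simp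
  then show ?thesis unfolding Ex1_def using assms by (intro definable) 
qed

section \<open>Models of ZF\<close>

text \<open>
  The two lemmas here return from definability to the form in which the axiom schemata of separation and
  replacement refer to formulas.
\<close>

lemma definable_formula1:
  assumes "definable E (\<lambda>v. P (v 0))"
  shows "\<exists>\<phi> v. \<forall>x. P x = sat E (v(0 := x)) \<phi>"
proof -
  obtain \<phi> t where \<phi>: "\<And>v. P (v 0) = sat E (valuation t v) \<phi>"
    using assms unfolding definable_def by blast
  define r where "r i = (case t i of Inl c \<Rightarrow> Suc i | Inr j \<Rightarrow> 0)" for i
  define w where "w k = valuation t (\<lambda>_. undefined) (k - 1)" for k
  obtain \<psi> where \<psi>: "\<And>v. sat E v \<psi> = sat E (\<lambda>i. v (r i)) \<phi>"
    using sat_rename[of E r] by blast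
  have "P x = sat E (w(0 := x)) \<psi>" for x
  proof -
    have "valuation t (\<lambda>_. x) = (\<lambda>i. (w(0 := x)) (r i))"
      by (rule ext) (auto simp: valuation_def r_def w_def split: sum.split)
    then show ?thesis using \<phi>[of "\<lambda>_. x"] by (simp only: \<psi>)
  qed
  then show ?thesis by blast
qed

lemma definable_formula2:
  assumes "definable E (\<lambda>v. P (v 0) (v 1))"
  shows "\<exists>\<phi> v. \<forall>x y. P x y = sat E (v(0 := x, 1 := y)) \<phi>"
proof -
  obtain \<phi> t where \<phi>: "\<And>v. P (v 0) (v 1) = sat E (valuation t v) \<phi>"
    using assms unfolding definable_def by blast
  define r where "r i = (if t i = Inr 0 then 0 else if t i = Inr 1 then 1 else i + 2)" for i
  define w where "w k = valuation t (\<lambda>_. undefined) (k - 2)" for k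
  obtain \<psi> where \<psi>: "\<And>v. sat E v \<psi> = sat E (\<lambda>i. v (r i)) \<phi>"
    using sat_rename[of E r] by blast
  have "P x y = sat E (w(0 := x, 1 := y)) \<psi>" for x y
  proof -
    define u where "u j = (if j = 0 then x else if j = 1 then y else undefined)" for j :: nat
    have "valuation t u = (\<lambda>i. (w(0 := x, 1 := y)) (r i))"
      by (rule ext) (auto simp: valuation_def r_def w_def u_def split: sum.split)
    moreover have "u 0 = x" "u 1 = y" by (simp_all add: u_def)
    ultimately show ?thesis using \<phi>[of u] by (simp only: \<psi>)
  qed
  then show ?thesis by blast
qed

locale zf_model =
  fixes E :: "'m \<Rightarrow> 'm \<Rightarrow> bool"
  assumes ZF: "ZF E"
begin

lemmas ZF_axioms = ZF[unfolded ZF_def]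

lemma elts_inject: "elts E x = elts E y \<longleftrightarrow> x = y"
  using ZF_axioms[THEN conjunct1] by metis

lemma foundation: "elts E x \<noteq> {} \<Longrightarrow> \<exists>y\<in>elts E x. elts E y \<inter> elts E x = {}"
  using ZF_axioms[THEN conjunct2, THEN conjunct1] by metis

lemma doubleton: "\<exists>s. elts E s = {x, y}"
  using ZF_axioms[THEN conjunct2, THEN conjunct2, THEN conjunct1] by metis

lemma union: "\<exists>s. elts E s = (\<Union>y\<in>elts E x. elts E y)"
  using ZF_axioms[THEN conjunct2, THEN conjunct2, THEN conjunct2, THEN conjunct1] by (rule spec)

lemma power: "\<exists>p. elts E p = {s. elts E s \<subseteq> elts E x}"
  using ZF_axioms[THEN conjunct2, THEN conjunct2, THEN conjunct2, THEN conjunct2, THEN conjunct1]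
  by (rule spec)

lemma inductive_exists: "\<exists>w. inductive_in E w"
  using ZF_axioms by (elim conjE)

lemma separation_formula: "\<exists>s. elts E s = {x \<in> elts E a. sat E (v(0 := x)) \<phi>}"
  using ZF_axioms by (elim conjE) (elim allE[of _ \<phi>] allE[of _ v] allE[of _ a], assumption)

lemma replacement_formula:
  "\<forall>x\<in>elts E a. \<forall>y y'. sat E (v(0 := x, 1 := y)) \<phi> \<longrightarrow> sat E (v(0 := x, 1 := y')) \<phi> \<longrightarrow> y = y'
   \<Longrightarrow> \<exists>s. elts E s = {y. \<exists>x\<in>elts E a. sat E (v(0 := x, 1 := y)) \<phi>}"
  using ZF_axioms by (elim conjE) meson

lemma separation:
  assumes "definable E (\<lambda>v. P (v 0))"
  shows "\<exists>s. elts E s = {x \<in> elts E a. P x}"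
proof -
  obtain \<phi> v where "\<And>x. P x = sat E (v(0 := x)) \<phi>"
    using definable_formula1[OF assms] by blast
  then show ?thesis using separation_formula[of a v \<phi>] by simp
qed

lemma replacement:
  assumes "definable E (\<lambda>v. P (v 0) (v 1))"
    and "\<And>x y y'. x \<in> elts E a \<Longrightarrow> P x y \<Longrightarrow> P x y' \<Longrightarrow> y = y'"
  shows "\<exists>s. elts E s = {y. \<exists>x\<in>elts E a. P x y}"
proof -
  obtain \<phi> v where \<phi>: "\<And>x y. P x y = sat E (v(0 := x, 1 := y)) \<phi>"
    using definable_formula2[OF assms(1)] by blast
  have "\<forall>x\<in>elts E a. \<forall>y y'. sat E (v(0 := x, 1 := y)) \<phi> \<longrightarrow>
      sat E (v(0 := x, 1 := y')) \<phi> \<longrightarrow> y = y'"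
    unfolding \<phi>[symmetric] using assms(2) by blast
  then show ?thesis unfolding \<phi> by (rule replacement_formula)
qed

lemma singleton: "\<exists>s. elts E s = {x}"
  using doubleton[of x x] by simp

lemma binary_union: "\<exists>s. elts E s = elts E x \<union> elts E y"
proof -
  obtain p where "elts E p = {x, y}" using doubleton by blast
  with union[of p] show ?thesis by simp
qed

lemma elts_empty: "elts E (empty_in E) = {}"
proof -
  have "\<exists>s. elts E s = {x \<in> elts E undefined. x \<noteq> x}"
    by (rule separation) (intro definable)
  then obtain s where "elts E s = {}" by auto
  then show ?thesis unfolding empty_in_def
    by (rule theI) (metis elts_inject \<open>elts E s = {}\<close>)
qed

lemma elts_succ: "elts E (succ_in E x) = insert x (elts E x)"
proof -
  obtain a where a: "elts E a = {x}" using singleton by blast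
  obtain s where s: "elts E s = elts E x \<union> elts E a" using binary_union by blast
  show ?thesis unfolding succ_in_def
    by (rule theI[of _ s]) (use a s in \<open>auto simp flip: elts_inject\<close>)
qed

lemma succ_unique: "elts E y = insert x (elts E x) \<longleftrightarrow> y = succ_in E x"
  by (metis elts_succ elts_inject)

lemma is_pair_unique: "is_pair E x y p \<Longrightarrow> is_pair E x y q \<Longrightarrow> p = q"
  unfolding is_pair_def by (metis elts_inject)

lemma is_pair_pair_in: "is_pair E x y (pair_in E x y)"
proof -
  obtain a b where ab: "elts E a = {x}" "elts E b = {x, y}" using doubleton singleton by metis
  obtain p where "elts E p = {a, b}" using doubleton by blast
  with ab have p: "is_pair E x y p" unfolding is_pair_def by blast
  then show ?thesis unfolding pair_in_def
    by (rule theI) (metis is_pair_unique p)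
qed

lemma is_pair_iff: "is_pair E x y p \<longleftrightarrow> p = pair_in E x y"
  using is_pair_pair_in is_pair_unique by blast

lemma pair_inject: "pair_in E x y = pair_in E x' y' \<longleftrightarrow> x = x' \<and> y = y'"
proof
  assume "pair_in E x y = pair_in E x' y'"
  then obtain a b a' b' where ab: "elts E a = {x}" "elts E b = {x, y}" "elts E a' = {x'}" "elts E b' = {x', y'}"
     and "{a, b} = {a', b'}"
    using is_pair_pair_in[of x y] is_pair_pair_in[of x' y'] unfolding is_pair_def by auto
  then consider "a = a'" "b = b'" | "a = b'" "b = a'" by (auto simp: doubleton_eq_iff)
  then show "x = x' \<and> y = y'" using ab by cases (auto simp: doubleton_eq_iff)
qed simp

lemma rel_in_iff: "rel_in E r x y \<longleftrightarrow> pair_in E x y \<in> elts E r"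
  by (auto simp: rel_in_def is_pair_iff)

lemma times_in_iff: "p \<in> times_in E A B \<longleftrightarrow> (\<exists>x\<in>A. \<exists>y\<in>B. p = pair_in E x y)"
  by (simp add: times_in_def is_pair_iff)

lemma pair_in_times: "pair_in E x y \<in> times_in E A B \<longleftrightarrow> x \<in> A \<and> y \<in> B"
  by (auto simp: times_in_iff pair_inject)

lemma mem_asym: "x \<in> elts E y \<Longrightarrow> y \<notin> elts E x"
proof
  assume *: "x \<in> elts E y" "y \<in> elts E x"
  obtain s where "elts E s = {x, y}" using doubleton by blast
  with foundation[of s] * show False by auto
qed

text \<open>
  By foundation there are no membership cycles of length two.
\<close>

lemma succ_inject: "succ_in E x = succ_in E y \<longleftrightarrow> x = y"
proof
  assume "succ_in E x = succ_in E y"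
  then have "insert x (elts E x) = insert y (elts E y)" by (metis elts_succ)
  then have "x = y \<or> x \<in> elts E y" "x = y \<or> y \<in> elts E x" by auto
  then show "x = y" using mem_asym by metis
qed simp

lemma succ_not_empty: "succ_in E x \<noteq> empty_in E"
  using elts_succ[of x] elts_empty by auto

lemma definable_set_eq_singleton [definable]:
  "definable_term E a \<Longrightarrow> definable_term E x \<Longrightarrow> definable E (\<lambda>v. elts E (a v) = {x v})"
  by (rule definable_rel2[where P = "\<lambda>a x. elts E a = {x}"])
     (simp_all only: set_eq_iff singleton_iff, intro definable)

lemma definable_set_eq_doubleton [definable]:
  "definable_term E a \<Longrightarrow> definable_term E x \<Longrightarrow> definable_term E y \<Longrightarrow>
    definable E (\<lambda>v. elts E (a v) = {x v, y v})"
  by (rule definable_rel3[where P = "\<lambda>a x y. elts E a = {x, y}"])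
     (simp_all only: set_eq_iff insert_iff empty_iff simp_thms, intro definable)

lemma definable_is_pair [definable]:
  "definable_term E x \<Longrightarrow> definable_term E y \<Longrightarrow> definable_term E p \<Longrightarrow>
    definable E (\<lambda>v. is_pair E (x v) (y v) (p v))"
  by (rule definable_rel3[where P = "is_pair E"]) (simp_all only: is_pair_def, intro definable)

lemma definable_pair_in [definable]:
  "definable_term E x \<Longrightarrow> definable_term E y \<Longrightarrow> definable_term E (\<lambda>v. pair_in E (x v) (y v))"
  by (rule definable_term2) (simp_all only: is_pair_iff[symmetric], intro definable)

lemma definable_succ_in [definable]:
  "definable_term E x \<Longrightarrow> definable_term E (\<lambda>v. succ_in E (x v))"
  by (rule definable_term1)
     (simp_all only: succ_unique[symmetric] set_eq_iff insert_iff, intro definable)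

lemma definable_rel_in [definable]:
  "definable_term E x \<Longrightarrow> definable_term E y \<Longrightarrow> definable_term E r \<Longrightarrow>
    definable E (\<lambda>v. rel_in E (r v) (x v) (y v))"
  unfolding rel_in_iff by (intro definable)

lemma times_exists: "\<exists>c. elts E c = times_in E (elts E a) (elts E b)"
proof -
  obtain s where s: "elts E s = elts E a \<union> elts E b" using binary_union by blast
  obtain p where p: "elts E p = {t. elts E t \<subseteq> elts E s}" using power by blast
  obtain q where q: "elts E q = {t. elts E t \<subseteq> elts E p}" using power by blast
  have "\<exists>c. elts E c = {t \<in> elts E q. \<exists>x\<in>elts E a. \<exists>y\<in>elts E b. is_pair E x y t}"
    by (rule separation) (intro definable)
  then obtain c where c: "elts E c = {t \<in> elts E q. \<exists>x\<in>elts E a. \<exists>y\<in>elts E b. is_pair E x y t}"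
    by blast
  have "t \<in> elts E q" if "x \<in> elts E a" "y \<in> elts E b" "is_pair E x y t" for x y t
    using that p q s unfolding is_pair_def by auto
  then have "elts E c = times_in E (elts E a) (elts E b)"
    using c unfolding times_in_def by auto
  then show ?thesis by blast
qed

lemma app_in_eq: "function_in E f A B \<Longrightarrow> x \<in> A \<Longrightarrow> rel_in E f x y \<Longrightarrow> app_in E f x = y"
  unfolding app_in_def function_in_def by (rule the1_equality) auto

lemma app_in_rel:
  assumes "function_in E f A B" "x \<in> A"
  shows "rel_in E f x (app_in E f x)"
proof -
  have "\<exists>!y. rel_in E f x y" using assms by (simp add: function_in_def)
  then show ?thesis unfolding app_in_def by (rule theI')
qed

lemma rel_in_app_iff: "function_in E f A B \<Longrightarrow> x \<in> A \<Longrightarrow> rel_in E f x y \<longleftrightarrow> app_in E f x = y"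
  using app_in_eq app_in_rel by metis

lemma rel_in_function: "function_in E f A B \<Longrightarrow> rel_in E f x y \<Longrightarrow> x \<in> A \<and> y \<in> B"
  unfolding function_in_def rel_in_iff using pair_in_times by blast

text \<open>
  The replacement schema turns a definable class function on a set into a function that is an element of
  the model.
\<close>

lemma function_of_graph:
  assumes P: "definable E (\<lambda>v. P (v 0) (v 1))"
    and ex1: "\<And>x. x \<in> elts E a \<Longrightarrow> \<exists>!y. P x y"
    and B: "\<And>x y. x \<in> elts E a \<Longrightarrow> P x y \<Longrightarrow> y \<in> B"
  shows "\<exists>f. function_in E f (elts E a) B \<and> (\<forall>x\<in>elts E a. P x (app_in E f x))"
proof -
  have "definable E (\<lambda>v. P (v (Suc 0)) (v 0))"
    using definable_rename[OF P, of "\<lambda>i. 1 - i"] by simp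
  then have "definable E (\<lambda>v. \<exists>y. P (v 0) y \<and> v 1 = pair_in E (v 0) y)"
    by (intro definable definable_rel2[OF P])
  moreover have "p = p'" if "x \<in> elts E a" "\<exists>y. P x y \<and> p = pair_in E x y"
    "\<exists>y. P x y \<and> p' = pair_in E x y" for x p p'
    using that ex1 by blast
  ultimately obtain f where f: "elts E f = {p. \<exists>x\<in>elts E a. \<exists>y. P x y \<and> p = pair_in E x y}"
    using replacement[of "\<lambda>x p. \<exists>y. P x y \<and> p = pair_in E x y" a] by blast
  then have rel: "rel_in E f x y \<longleftrightarrow> x \<in> elts E a \<and> P x y" for x y
    by (auto simp: rel_in_iff pair_inject)
  have "elts E f \<subseteq> times_in E (elts E a) B"
    using f B by (auto simp: pair_in_times)
  then have "function_in E f (elts E a) B"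
    unfolding function_in_def rel using ex1 by simp
  moreover from this have "P x (app_in E f x)" if "x \<in> elts E a" for x
    using app_in_rel that rel by blast
  ultimately show ?thesis by blast
qed

lemma function_of_term:
  assumes "definable_term E (\<lambda>v. t (v 0))" "\<And>x. x \<in> elts E a \<Longrightarrow> t x \<in> B"
  shows "\<exists>f. function_in E f (elts E a) B \<and> (\<forall>x\<in>elts E a. app_in E f x = t x)"
proof (rule function_of_graph)
  show "definable E (\<lambda>v. v 1 = t (v 0))"
    by (rule definable_eq) (use assms(1) definable in blast)+
qed (use assms(2) in auto)

end

section \<open>Orbits and countability\<close>

text \<open>
  Minimality is required among sets of the model, as a first-order condition, and therefore yields induction
  for definable properties.
\<close>

definition least_closed :: "('m \<Rightarrow> 'm \<Rightarrow> bool) \<Rightarrow> 'm \<Rightarrow> ('m \<Rightarrow> 'm \<Rightarrow> bool) \<Rightarrow> 'm \<Rightarrow> bool" where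
  "least_closed E b G L \<longleftrightarrow>
     b \<in> elts E L \<and> (\<forall>x\<in>elts E L. \<forall>y. G x y \<longrightarrow> y \<in> elts E L) \<and>
     (\<forall>A. b \<in> elts E A \<longrightarrow> (\<forall>x\<in>elts E A. \<forall>y. G x y \<longrightarrow> y \<in> elts E A) \<longrightarrow> elts E L \<subseteq> elts E A)"

abbreviation orbit :: "('m \<Rightarrow> 'm \<Rightarrow> bool) \<Rightarrow> ('m \<Rightarrow> 'm) \<Rightarrow> 'm \<Rightarrow> 'm \<Rightarrow> bool" where
  "orbit E T b L \<equiv> least_closed E b (\<lambda>x y. y = T x) L"

context zf_model
begin

text \<open>
  The intersection of all closed sets of the model, cut out of one closed set \<open>W\<close> by separation.
\<close>

lemma least_closed_exists:
  assumes G: "definable E (\<lambda>v. G (v 0) (v 1))"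
    and b: "b \<in> elts E W" and W: "\<And>x y. x \<in> elts E W \<Longrightarrow> G x y \<Longrightarrow> y \<in> elts E W"
  shows "\<exists>L. elts E L \<subseteq> elts E W \<and> least_closed E b G L"
proof -
  let ?closed = "\<lambda>A. \<forall>x\<in>elts E A. \<forall>y. G x y \<longrightarrow> y \<in> elts E A"
  have "\<exists>L. elts E L = {x \<in> elts E W. \<forall>A. b \<in> elts E A \<longrightarrow> ?closed A \<longrightarrow> x \<in> elts E A}"
    by (rule separation) (intro definable definable_rel2[OF G])
  then obtain L where L: "elts E L = {x \<in> elts E W. \<forall>A. b \<in> elts E A \<longrightarrow> ?closed A \<longrightarrow> x \<in> elts E A}"
    by blast
  have "least_closed E b G L" unfolding least_closed_def L using b W by blast
  with L show ?thesis by blast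
qed

lemma least_closed_base: "least_closed E b G L \<Longrightarrow> b \<in> elts E L"
  by (simp add: least_closed_def)

lemma least_closed_step: "least_closed E b G L \<Longrightarrow> x \<in> elts E L \<Longrightarrow> G x y \<Longrightarrow> y \<in> elts E L"
  unfolding least_closed_def by blast

lemma least_closed_induct:
  assumes L: "least_closed E b G L" and P: "definable E (\<lambda>v. P (v 0))"
    and base: "P b" and step: "\<And>x y. x \<in> elts E L \<Longrightarrow> P x \<Longrightarrow> G x y \<Longrightarrow> P y"
    and x: "x \<in> elts E L"
  shows "P x"
proof -
  obtain A where A: "elts E A = {x \<in> elts E L. P x}" using separation[OF P] by blast
  have "b \<in> elts E A" using A base least_closed_base[OF L] by simp
  moreover have "\<forall>x\<in>elts E A. \<forall>y. G x y \<longrightarrow> y \<in> elts E A"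
    unfolding A using step least_closed_step[OF L] by blast
  ultimately have "elts E L \<subseteq> elts E A" using L unfolding least_closed_def by blast
  with A x show ?thesis by blast
qed

lemma orbit_step: "orbit E T b L \<Longrightarrow> x \<in> elts E L \<Longrightarrow> T x \<in> elts E L"
  unfolding least_closed_def by blast

lemma orbit_induct:
  assumes "orbit E T b L" "definable E (\<lambda>v. P (v 0))"
    "P b" "\<And>x. x \<in> elts E L \<Longrightarrow> P x \<Longrightarrow> P (T x)" "x \<in> elts E L"
  shows "P x"
  by (rule least_closed_induct[OF assms(1), of P]) (use assms in blast)+

lemma inductive_in_iff:
  "inductive_in E w \<longleftrightarrow> empty_in E \<in> elts E w \<and> (\<forall>x\<in>elts E w. succ_in E x \<in> elts E w)"
proof -
  have "elts E z = {} \<longleftrightarrow> z = empty_in E" for z by (metis elts_empty elts_inject)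
  then show ?thesis unfolding inductive_in_def succ_unique by auto
qed

lemma omega_exists: "\<exists>w. elts E w = omega_in E \<and> orbit E (succ_in E) (empty_in E) w"
proof -
  obtain w0 where w0: "inductive_in E w0" using inductive_exists by blast
  have "\<exists>w. elts E w \<subseteq> elts E w0 \<and> orbit E (succ_in E) (empty_in E) w"
  proof (rule least_closed_exists)
    show "definable E (\<lambda>v. v 1 = succ_in E (v 0))" by (intro definable)
  qed (use w0 in \<open>auto simp: inductive_in_iff\<close>)
  then obtain w where w: "orbit E (succ_in E) (empty_in E) w" by blast
  have "inductive_in E w"
    using least_closed_base[OF w] orbit_step[OF w] by (simp add: inductive_in_iff)
  moreover have "elts E w \<subseteq> elts E A" if "inductive_in E A" for A
    using w that by (auto simp: inductive_in_iff least_closed_def)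
  ultimately have "elts E w = omega_in E" unfolding omega_in_def by blast
  with w show ?thesis by blast
qed

lemma empty_in_omega: "empty_in E \<in> omega_in E"
  by (simp add: omega_in_def inductive_in_iff)

lemma succ_in_omega: "n \<in> omega_in E \<Longrightarrow> succ_in E n \<in> omega_in E"
  by (simp add: omega_in_def inductive_in_iff)

text \<open>
  Dedekind's recursion argument. If two values were related to the base point or to a successor \<open>S c\<close>, all
  but the expected one could be removed from \<open>H\<close>, which would stay closed because \<open>S\<close> is injective and
  avoids the base point; the premise \<open>min\<close> says that \<open>H\<close> is the least such relation among the definable
  ones. It will be applied to a relation and to its converse, with the roles of \<open>S\<close> and \<open>T\<close> exchanged.
\<close>

lemma functional_if_minimal:
  assumes A: "orbit E S a0 A" and inj: "inj_on S (elts E A)" and a0: "a0 \<notin> S ` elts E A"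
    and H: "definable E (\<lambda>v. H (v 0) (v 1))"
    and base: "H a0 b0" and step: "\<And>a b. H a b \<Longrightarrow> H (S a) (T b)"
    and fld: "\<And>a b. H a b \<Longrightarrow> a \<in> elts E A"
    and min: "\<And>K a b. definable E (\<lambda>v. K (v 0) (v 1)) \<Longrightarrow> K a0 b0 \<Longrightarrow>
        (\<And>a b. H a b \<Longrightarrow> K a b \<Longrightarrow> K (S a) (T b)) \<Longrightarrow> H a b \<Longrightarrow> K a b"
    and a: "a \<in> elts E A"
  shows "\<exists>!b. H a b"
  using A _ _ _ a
proof (rule orbit_induct)
  show "definable E (\<lambda>v. \<exists>!b. H (v 0) b)" by (intro definable definable_rel2[OF H])
  have "a = a0 \<longrightarrow> b = b0" if "H a b" for a b
    by (rule min[where K = "\<lambda>a b. a = a0 \<longrightarrow> b = b0", OF _ _ _ that])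
       (intro definable, use a0 fld in auto)
  then show "\<exists>!b. H a0 b" using base by blast
next
  fix c assume c: "c \<in> elts E A" and "\<exists>!b. H c b"
  then obtain d where d: "H c d" "\<And>b. H c b \<Longrightarrow> b = d" by blast
  have "a = S c \<longrightarrow> b = T d" if "H a b" for a b
  proof (rule min[where K = "\<lambda>a b. a = S c \<longrightarrow> b = T d", OF _ _ _ that])
    show "definable E (\<lambda>v. v 0 = S c \<longrightarrow> v 1 = T d)" by (intro definable)
    show "a0 = S c \<longrightarrow> b0 = T d" using a0 c by blast
    show "S a' = S c \<longrightarrow> T b' = T d" if "H a' b'" for a' b'
      using that inj c d(2) fld by (auto simp: inj_on_eq_iff)
  qed
  then show "\<exists>!b. H (S c) b" using step[OF d(1)] by blast
qed

text \<open>
  The orbit of \<open>b0\<close> satisfies the Peano axioms with respect to \<open>T\<close>, just as \<open>\<omega>\<close> does with respect to the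
  successor. The least relation that contains the pair of base points and is closed under stepping in both
  components is therefore functional in both directions, hence an isomorphism of the two structures.
\<close>

lemma orbit_countable:
  assumes L: "orbit E T b0 L" and T: "definable E (\<lambda>v. v 0 = T (v 1))"
    and inj: "inj_on T (elts E L)" and b0: "b0 \<notin> T ` elts E L"
  shows "\<exists>c. function_in E c (elts E L) (omega_in E) \<and> inj_on (app_in E c) (elts E L)"
proof -
  obtain w where w: "elts E w = omega_in E" "orbit E (succ_in E) (empty_in E) w"
    using omega_exists by blast
  obtain W where W: "elts E W = times_in E (elts E w) (elts E L)" using times_exists by blast
  let ?G = "\<lambda>p q. \<exists>n x. p = pair_in E n x \<and> q = pair_in E (succ_in E n) (T x)"
  have "\<exists>h. elts E h \<subseteq> elts E W \<and> least_closed E (pair_in E (empty_in E) b0) ?G h"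
  proof (rule least_closed_exists)
    show "definable E (\<lambda>v. ?G (v 0) (v 1))" by (intro definable definable_term1[OF T])
    show "pair_in E (empty_in E) b0 \<in> elts E W"
      using W least_closed_base[OF w(2)] least_closed_base[OF L] by (simp add: pair_in_times)
    show "q \<in> elts E W" if "p \<in> elts E W" "?G p q" for p q
      using that W orbit_step[OF w(2)] orbit_step[OF L] by (auto simp: pair_in_times)
  qed
  then obtain h where hW: "elts E h \<subseteq> elts E W"
    and h: "least_closed E (pair_in E (empty_in E) b0) ?G h" by blast
  define H where "H n x \<longleftrightarrow> pair_in E n x \<in> elts E h" for n x
  have defH: "definable E (\<lambda>v. H (v 0) (v 1))" unfolding H_def by (intro definable)
  have base: "H (empty_in E) b0" unfolding H_def by (rule least_closed_base[OF h])
  have step: "H (succ_in E n) (T x)" if "H n x" for n x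
    using least_closed_step[OF h that[unfolded H_def]] unfolding H_def by blast
  have fld: "n \<in> elts E w \<and> x \<in> elts E L" if "H n x" for n x
    using that hW W by (auto simp: H_def pair_in_times)
  have min: "K n x" if K: "definable E (\<lambda>v. K (v 0) (v 1))" "K (empty_in E) b0"
     "\<And>n x. H n x \<Longrightarrow> K n x \<Longrightarrow> K (succ_in E n) (T x)" and "H n x" for K n x
  proof -
    have "\<forall>n x. p = pair_in E n x \<longrightarrow> K n x" if "p \<in> elts E h" for p
    proof (rule least_closed_induct[OF h _ _ _ that])
      show "definable E (\<lambda>v. \<forall>n x. v 0 = pair_in E n x \<longrightarrow> K n x)"
        by (intro definable definable_rel2[OF K(1)])
      show "\<forall>n x. pair_in E (empty_in E) b0 = pair_in E n x \<longrightarrow> K n x"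
        using K(2) by (simp add: pair_inject)
      show "\<forall>n x. q = pair_in E n x \<longrightarrow> K n x"
        if "p \<in> elts E h" "\<forall>n x. p = pair_in E n x \<longrightarrow> K n x" "?G p q" for p q
        using that K(3) by (auto simp: pair_inject H_def)
    qed
    then show ?thesis using \<open>H n x\<close> unfolding H_def by blast
  qed
  have fun1: "\<exists>!x. H n x" if "n \<in> elts E w" for n
  proof (rule functional_if_minimal[where H = H and T = T, OF w(2) _ _ defH base step _ _ that])
    show "inj_on (succ_in E) (elts E w)" by (simp add: inj_on_def succ_inject)
    show "empty_in E \<notin> succ_in E ` elts E w" using succ_not_empty by (metis imageE)
  qed (use fld min in blast)+
  have defH': "definable E (\<lambda>v. H (v 1) (v 0))"
    by (rule definable_rel2[OF defH]) (intro definable)+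
  have fun2: "\<exists>!n. H n x" if "x \<in> elts E L" for x
  proof (rule functional_if_minimal[where H = "\<lambda>x n. H n x" and T = "succ_in E",
        OF L inj b0 defH' base step _ _ that])
    fix K x n assume K: "definable E (\<lambda>v. K (v 0) (v 1))" "K b0 (empty_in E)"
      "\<And>x n. H n x \<Longrightarrow> K x n \<Longrightarrow> K (T x) (succ_in E n)" and "H n x"
    have "definable E (\<lambda>v. K (v 1) (v 0))" by (rule definable_rel2[OF K(1)]) (intro definable)+
    from min[of "\<lambda>n x. K x n", OF this K(2) K(3) \<open>H n x\<close>] show "K x n" .
  qed (use fld in auto)
  have "\<exists>c. function_in E c (elts E L) (omega_in E) \<and> (\<forall>x\<in>elts E L. H (app_in E c x) x)"
    by (rule function_of_graph[OF defH' fun2]) (use fld w in auto)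
  then obtain c where c: "function_in E c (elts E L) (omega_in E)"
    "\<And>x. x \<in> elts E L \<Longrightarrow> H (app_in E c x) x" by blast
  have "inj_on (app_in E c) (elts E L)"
  proof (rule inj_onI)
    fix x y assume "x \<in> elts E L" "y \<in> elts E L" "app_in E c x = app_in E c y"
    then have "H (app_in E c x) x" "H (app_in E c x) y" using c(2) by metis+
    with fld fun1 show "x = y" by blast
  qed
  with c(1) show ?thesis by blast
qed

text \<open>
  The labelling followed by an injection of the set of labels into \<open>\<omega>\<close>, made into a function of the
  model.
\<close>

lemma countable_if_labelled:
  assumes c: "function_in E c (elts E L) (omega_in E)" "inj_on (app_in E c) (elts E L)"
    and lab: "definable E (\<lambda>v. lab (v 0) (v 1))"
    and ex: "\<And>x. x \<in> elts E X \<Longrightarrow> \<exists>!p. p \<in> elts E L \<and> lab x p"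
    and inj: "\<And>x y p. x \<in> elts E X \<Longrightarrow> y \<in> elts E X \<Longrightarrow> p \<in> elts E L \<Longrightarrow>
        lab x p \<Longrightarrow> lab y p \<Longrightarrow> x = y"
  shows "\<not> uncountable_in E X"
proof -
  have rel: "rel_in E c p n \<longleftrightarrow> p \<in> elts E L \<and> n = app_in E c p" for p n
    using app_in_eq[OF c(1)] app_in_rel[OF c(1)] rel_in_function[OF c(1)] by metis
  let ?P = "\<lambda>x n. \<exists>p. p \<in> elts E L \<and> lab x p \<and> rel_in E c p n"
  have "\<exists>f. function_in E f (elts E X) (omega_in E) \<and> (\<forall>x\<in>elts E X. ?P x (app_in E f x))"
  proof (rule function_of_graph)
    show "definable E (\<lambda>v. ?P (v 0) (v 1))" by (intro definable definable_rel2[OF lab])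
    show "\<exists>!n. ?P x n" if "x \<in> elts E X" for x using ex[OF that] unfolding rel by blast
    show "n \<in> omega_in E" if "?P x n" for x n
      using that rel_in_function[OF c(1)] by blast
  qed
  then obtain f where f: "function_in E f (elts E X) (omega_in E)"
    "\<And>x. x \<in> elts E X \<Longrightarrow> ?P x (app_in E f x)" by blast
  have "inj_on (app_in E f) (elts E X)"
  proof (rule inj_onI)
    fix x y assume xy: "x \<in> elts E X" "y \<in> elts E X" "app_in E f x = app_in E f y"
    obtain p where p: "p \<in> elts E L" "lab x p" "app_in E f x = app_in E c p"
      using f(2)[OF xy(1)] rel by blast
    obtain q where q: "q \<in> elts E L" "lab y q" "app_in E f y = app_in E c q"
      using f(2)[OF xy(2)] rel by blast
    have "p = q" using p q xy(3) inj_onD[OF c(2), of p q] by simp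
    then show "x = y" using inj xy p q by blast
  qed
  with f(1) show ?thesis unfolding uncountable_in_def by blast
qed

end

section \<open>The reals of a model as an ordered field\<close>

text \<open>
  The locale views the reals of the model from outside as an ordered field. The operations are extended
  to the whole type by a default value outside the carrier, because the total functions are what the
  closure rules for definability can compose.
\<close>

locale model_reals = zf_model E for E :: "'m \<Rightarrow> 'm \<Rightarrow> bool" +
  fixes R radd rmul rle z u :: 'm
  assumes reals: "reals_in E R radd rmul rle z u"
begin

abbreviation "F \<equiv> ring_in E R radd rmul z u"

abbreviation "K \<equiv> elts E R"

definition less :: "'m \<Rightarrow> 'm \<Rightarrow> bool" (infix "\<prec>" 50) where
  "x \<prec> y \<longleftrightarrow> rel_in E rle x y \<and> x \<noteq> y"

definition less_eq :: "'m \<Rightarrow> 'm \<Rightarrow> bool" (infix "\<preceq>" 50) where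
  "x \<preceq> y \<longleftrightarrow> x \<prec> y \<or> x = y"

definition plus :: "'m \<Rightarrow> 'm \<Rightarrow> 'm" (infixl "\<^bold>+" 65) where
  "x \<^bold>+ y = (if x \<in> K \<and> y \<in> K then x \<oplus>\<^bsub>F\<^esub> y else z)"

definition neg :: "'m \<Rightarrow> 'm" where
  "neg x = (if x \<in> K then \<ominus>\<^bsub>F\<^esub> x else z)"

definition recip :: "'m \<Rightarrow> 'm" where
  "recip x = (if x \<in> K \<and> x \<noteq> z then inv\<^bsub>F\<^esub> x else z)"

lemma ring_in_simps [simp]:
  "carrier F = K" "\<one>\<^bsub>F\<^esub> = u" "\<zero>\<^bsub>F\<^esub> = z"
  "x \<oplus>\<^bsub>F\<^esub> y = op_in E radd x y" "x \<otimes>\<^bsub>F\<^esub> y = op_in E rmul x y"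
  by (simp_all add: ring_in_def)

lemma field_F: "field F"
  and radd_function: "function_in E radd (times_in E K K) K"
  and rmul_function: "function_in E rmul (times_in E K K) K"
  and rle_subset: "elts E rle \<subseteq> times_in E K K"
  and rle_linear: "linear_order_on K {(x, y). rel_in E rle x y}"
  and rle_add: "\<And>x y w. x \<in> K \<Longrightarrow> y \<in> K \<Longrightarrow> w \<in> K \<Longrightarrow> rel_in E rle x y \<Longrightarrow>
    rel_in E rle (op_in E radd x w) (op_in E radd y w)"
  and rle_mult: "\<And>x y. x \<in> K \<Longrightarrow> y \<in> K \<Longrightarrow> rel_in E rle z x \<Longrightarrow> rel_in E rle z y \<Longrightarrow>
    rel_in E rle z (op_in E rmul x y)"
  and rle_complete: "\<And>S. elts E S \<subseteq> K \<Longrightarrow> elts E S \<noteq> {} \<Longrightarrow>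
    (\<exists>b\<in>K. \<forall>s\<in>elts E S. rel_in E rle s b) \<Longrightarrow>
    (\<exists>b\<in>K. (\<forall>s\<in>elts E S. rel_in E rle s b) \<and>
       (\<forall>c\<in>K. (\<forall>s\<in>elts E S. rel_in E rle s c) \<longrightarrow> rel_in E rle b c))"
  using reals unfolding reals_in_def by (elim conjE; simp)+

end

sublocale model_reals \<subseteq> F: field F by (rule field_F)

context model_reals
begin

lemma less_in_K: "x \<prec> y \<Longrightarrow> x \<in> K \<and> y \<in> K"
  unfolding less_def rel_in_iff using rle_subset pair_in_times by blast

lemma rle_iff: "x \<in> K \<Longrightarrow> y \<in> K \<Longrightarrow> rel_in E rle x y \<longleftrightarrow> x \<preceq> y"
  using rle_linear
  by (auto simp: less_eq_def less_def linear_order_on_def partial_order_on_def preorder_on_def refl_on_def)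

lemma less_trans: "x \<prec> y \<Longrightarrow> y \<prec> w \<Longrightarrow> x \<prec> w"
  using rle_linear unfolding less_def linear_order_on_def partial_order_on_def preorder_on_def
  by (auto dest: transD antisymD)

lemma less_asym: "x \<prec> y \<Longrightarrow> \<not> y \<prec> x"
  using rle_linear unfolding less_def linear_order_on_def partial_order_on_def preorder_on_def
  by (auto dest: antisymD)

lemma not_less: "x \<in> K \<Longrightarrow> y \<in> K \<Longrightarrow> \<not> x \<prec> y \<longleftrightarrow> y \<preceq> x"
  using rle_linear less_asym unfolding less_eq_def linear_order_on_def total_on_def
  by (auto simp: less_def)

end

sublocale model_reals \<subseteq> order "(\<preceq>)" "(\<prec>)"
  by unfold_locales (auto simp: less_eq_def dest: less_trans less_asym)

context model_reals
begin

lemma zero_in_K: "z \<in> K" and one_in_K: "u \<in> K"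
  using F.zero_closed F.one_closed by simp_all

lemma plus_closed [simp]: "x \<^bold>+ y \<in> K"
  using F.a_closed[of x y] zero_in_K by (simp add: plus_def)

lemma neg_closed [simp]: "neg x \<in> K"
  using F.a_inv_closed[of x] zero_in_K by (simp add: neg_def)

lemma recip_closed [simp]: "recip x \<in> K"
  using F.Units_inv_closed[of x] zero_in_K F.field_Units by (auto simp: recip_def)

lemma plus_less_mono1:
  assumes "x \<prec> y" "w \<in> K" shows "x \<^bold>+ w \<prec> y \<^bold>+ w"
proof -
  have xy: "x \<in> K" "y \<in> K" "x \<noteq> y" using less_in_K assms(1) by auto
  have "rel_in E rle (op_in E radd x w) (op_in E radd y w)"
    using rle_add xy assms by (auto simp: less_def)
  moreover have "op_in E radd x w \<noteq> op_in E radd y w"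
    using F.add.right_cancel[of w x y] xy assms(2) by simp
  ultimately show ?thesis using xy assms(2) by (simp add: less_def plus_def)
qed

lemma plus_comm: "x \<^bold>+ y = y \<^bold>+ x"
  using F.a_comm[of x y] by (simp add: plus_def)

lemma plus_less_mono2: "x \<prec> y \<Longrightarrow> w \<in> K \<Longrightarrow> w \<^bold>+ x \<prec> w \<^bold>+ y"
  using plus_less_mono1[of x y w] by (simp add: plus_comm[of w])

lemma plus_less_mono: "a \<prec> b \<Longrightarrow> c \<prec> d \<Longrightarrow> a \<^bold>+ c \<prec> b \<^bold>+ d"
  by (rule less_trans[of _ "b \<^bold>+ c"]) (simp_all add: less_in_K plus_less_mono1 plus_less_mono2)

lemma plus_mono: "a \<preceq> b \<Longrightarrow> c \<preceq> d \<Longrightarrow> b \<in> K \<Longrightarrow> d \<in> K \<Longrightarrow> a \<^bold>+ c \<preceq> b \<^bold>+ d"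
  unfolding less_eq_def using plus_less_mono plus_less_mono1 plus_less_mono2 by blast

lemma zero_plus: "x \<in> K \<Longrightarrow> z \<^bold>+ x = x"
  using F.l_zero[of x] zero_in_K by (simp add: plus_def)

lemma neg_eq_iff: "x \<in> K \<Longrightarrow> y = neg x \<longleftrightarrow> y \<in> K \<and> y \<^bold>+ x = z"
  using F.minus_unique[of "y" x "y"] F.minus_equality[of y x] F.l_neg[of x] neg_closed[of x]
  by (auto simp: neg_def plus_def)

lemma neg_neg: "x \<in> K \<Longrightarrow> neg (neg x) = x"
  using F.minus_minus[of x] F.a_inv_closed[of x] by (simp add: neg_def)

lemma neg_plus: "x \<in> K \<Longrightarrow> y \<in> K \<Longrightarrow> neg (x \<^bold>+ y) = neg x \<^bold>+ neg y"
  using F.minus_add[of x y] F.a_inv_closed[of x] F.a_inv_closed[of y] F.a_closed[of x y]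
  by (simp add: neg_def plus_def)

lemma plus_neg_cancel: "x \<in> K \<Longrightarrow> y \<in> K \<Longrightarrow> x \<^bold>+ (neg x \<^bold>+ y) = y"
  using F.r_neg2[of x y] F.a_inv_closed[of x] F.a_closed[of "\<ominus>\<^bsub>F\<^esub> x" y]
  by (simp add: plus_def neg_def)

lemma neg_less: "x \<prec> y \<Longrightarrow> neg y \<prec> neg x"
proof -
  assume xy: "x \<prec> y"
  then have K: "x \<in> K" "y \<in> K" using less_in_K by auto
  have "x \<^bold>+ (neg x \<^bold>+ neg y) \<prec> y \<^bold>+ (neg x \<^bold>+ neg y)" by (rule plus_less_mono1[OF xy]) simp
  moreover have "x \<^bold>+ (neg x \<^bold>+ neg y) = neg y" "y \<^bold>+ (neg x \<^bold>+ neg y) = neg x"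
    using K plus_neg_cancel[of x "neg y"] plus_neg_cancel[of y "neg x"] plus_comm[of "neg x" "neg y"]
    by simp_all
  ultimately show ?thesis by simp
qed

lemma neg_zero: "neg z = z"
  using F.minus_zero zero_in_K by (simp add: neg_def)

lemma neg_pos: "z \<prec> neg x \<longleftrightarrow> x \<prec> z"
  using neg_less[of x z] neg_less[of z "neg x"] neg_zero neg_neg less_in_K
  by (metis neg_def less_irrefl)

definition times :: "'m \<Rightarrow> 'm \<Rightarrow> 'm" (infixl "\<^bold>*" 70) where
  "x \<^bold>* y = x \<otimes>\<^bsub>F\<^esub> y"

lemma times_closed: "x \<in> K \<Longrightarrow> y \<in> K \<Longrightarrow> x \<^bold>* y \<in> K"
  using F.m_closed[of x y] by (simp add: times_def)

lemma times_comm: "x \<in> K \<Longrightarrow> y \<in> K \<Longrightarrow> x \<^bold>* y = y \<^bold>* x"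
  using F.m_comm[of x y] by (simp add: times_def)

lemma times_assoc: "x \<in> K \<Longrightarrow> y \<in> K \<Longrightarrow> w \<in> K \<Longrightarrow> x \<^bold>* y \<^bold>* w = x \<^bold>* (y \<^bold>* w)"
  using F.m_assoc[of x y w] by (simp add: times_def)

lemma one_times: "x \<in> K \<Longrightarrow> u \<^bold>* x = x"
  using F.l_one[of x] by (simp add: times_def)

lemma distrib: "x \<in> K \<Longrightarrow> y \<in> K \<Longrightarrow> w \<in> K \<Longrightarrow> (x \<^bold>+ y) \<^bold>* w = x \<^bold>* w \<^bold>+ y \<^bold>* w"
  using F.l_distr[of x y w] F.m_closed[of x w] F.m_closed[of y w] by (simp add: times_def plus_def)

lemma neg_times: "x \<in> K \<Longrightarrow> y \<in> K \<Longrightarrow> neg x \<^bold>* y = neg (x \<^bold>* y)"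
  using F.l_minus[of x y] F.m_closed[of x y] by (simp add: times_def neg_def)

lemma times_recip: "x \<in> K \<Longrightarrow> x \<noteq> z \<Longrightarrow> x \<^bold>* recip x = u"
  using F.Units_r_inv[of x] F.field_Units by (simp add: times_def recip_def)

lemma times_pos: "z \<prec> x \<Longrightarrow> z \<prec> y \<Longrightarrow> z \<prec> x \<^bold>* y"
proof -
  assume xy: "z \<prec> x" "z \<prec> y"
  then have "x \<in> K" "y \<in> K" "x \<noteq> z" "y \<noteq> z" using less_in_K by auto
  then have "x \<^bold>* y \<noteq> z" using F.integral_iff[of x y] by (simp add: times_def)
  moreover have "rel_in E rle z (x \<^bold>* y)"
    using rle_mult[of x y] xy \<open>x \<in> K\<close> \<open>y \<in> K\<close> by (simp add: less_def times_def)
  ultimately show ?thesis by (simp add: less_def)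
qed

lemma one_pos: "z \<prec> u"
proof (rule ccontr)
  assume "\<not> z \<prec> u"
  moreover have "u \<noteq> z" using F.one_not_zero by simp
  ultimately have "u \<prec> z" using not_less[OF zero_in_K one_in_K] by (simp add: less_eq_def)
  then have n: "z \<prec> neg u" using neg_pos by simp
  have "z \<prec> neg u \<^bold>* neg u" by (rule times_pos[OF n n])
  also have "neg u \<^bold>* neg u = u"
    using neg_times[of u "neg u"] one_times[of "neg u"] neg_neg[of u] one_in_K by simp
  finally show False using \<open>\<not> z \<prec> u\<close> by simp
qed

lemma recip_eq_iff:
  assumes "x \<in> K" "x \<noteq> z"
  shows "y = recip x \<longleftrightarrow> y \<in> K \<and> x \<^bold>* y = u"
proof
  assume y: "y \<in> K \<and> x \<^bold>* y = u"
  have "y = (recip x \<^bold>* x) \<^bold>* y" using assms y times_recip times_comm one_times by simp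
  also have "\<dots> = recip x"
    using assms y times_comm[of "recip x" u] one_times one_in_K by (simp add: times_assoc)
  finally show "y = recip x" .
qed (use assms times_recip in simp)

lemma recip_pos: "z \<prec> x \<Longrightarrow> z \<prec> recip x"
proof (rule ccontr)
  assume x: "z \<prec> x" and n: "\<not> z \<prec> recip x"
  then have K: "x \<in> K" "x \<noteq> z" using less_in_K by auto
  have xr: "x \<^bold>* recip x = u" by (rule times_recip[OF K])
  have "recip x \<noteq> z"
  proof
    assume "recip x = z"
    then have "u = z" using xr F.r_null[of x] K by (simp add: times_def)
    then show False using one_pos by simp
  qed
  then have "recip x \<prec> z" using n not_less[OF zero_in_K recip_closed] by (simp add: less_eq_def)
  then have "z \<prec> neg (recip x)" using neg_pos by simp
  then have "z \<prec> neg (recip x) \<^bold>* x" using x by (rule times_pos)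
  also have "\<dots> = neg u" using neg_times[of "recip x" x] times_comm[of x "recip x"] xr K by simp
  finally have "u \<prec> z" using neg_pos by simp
  then show False using one_pos less_asym by blast
qed

lemma recip_recip: "z \<prec> x \<Longrightarrow> recip (recip x) = x"
proof -
  assume x: "z \<prec> x"
  then have K: "x \<in> K" "x \<noteq> z" using less_in_K by auto
  have "recip x \<noteq> z" using recip_pos[OF x] by auto
  then show ?thesis
    using recip_eq_iff[of "recip x" x] times_recip[OF K] times_comm[of x "recip x"] K by simp
qed

lemma recip_one: "recip u = u"
  using recip_eq_iff[of u u] one_in_K one_pos one_times by auto

lemma recip_less:
  assumes x: "z \<prec> x" and xy: "x \<prec> y"
  shows "recip y \<prec> recip x"
proof -
  have y: "z \<prec> y" using x xy less_trans by blast
  have K: "x \<in> K" "y \<in> K" "x \<noteq> z" "y \<noteq> z" using x y less_in_K by auto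
  let ?w = "recip x \<^bold>* recip y"
  have "x \<^bold>+ neg x \<prec> y \<^bold>+ neg x" by (rule plus_less_mono1[OF xy]) simp
  then have "z \<prec> y \<^bold>+ neg x" using neg_eq_iff[of x "neg x"] plus_comm K by simp
  then have "z \<prec> (y \<^bold>+ neg x) \<^bold>* ?w" by (rule times_pos[OF _ times_pos[OF recip_pos[OF x] recip_pos[OF y]]])
  also have "\<dots> = y \<^bold>* ?w \<^bold>+ neg (x \<^bold>* ?w)" using K by (simp add: distrib neg_times times_closed)
  also have "x \<^bold>* ?w = recip y" using K by (simp add: times_recip one_times flip: times_assoc)
  also have "y \<^bold>* ?w = recip x"
    using K times_comm[of "recip x" "recip y"] by (simp add: times_recip one_times flip: times_assoc)
  finally have "z \<^bold>+ recip y \<prec> (recip x \<^bold>+ neg (recip y)) \<^bold>+ recip y"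
    by (rule plus_less_mono1) simp
  also have "\<dots> = recip x"
    using F.a_assoc[of "recip x" "neg (recip y)" "recip y"] neg_eq_iff[of "recip y" "neg (recip y)"]
      zero_plus[of "recip x"] plus_comm[of "recip x" z] zero_in_K plus_closed[of "recip x" "neg (recip y)"]
      plus_closed[of "neg (recip y)" "recip y"]
    by (simp add: plus_def)
  finally show ?thesis by (simp add: zero_plus)
qed

definition double :: "'m \<Rightarrow> 'm" where "double x = x \<^bold>+ x"

definition quad :: "'m \<Rightarrow> 'm" where "quad x = double (double x)"

lemma double_closed [simp]: "double x \<in> K" by (simp add: double_def)

lemma quad_closed [simp]: "quad x \<in> K" by (simp add: quad_def)

lemma less_double: "z \<prec> x \<Longrightarrow> x \<prec> double x"
  using plus_less_mono1[of z x x] less_in_K[of z x] zero_plus by (simp add: double_def)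

lemma double_pos: "z \<prec> x \<Longrightarrow> z \<prec> double x"
  using less_double less_trans by blast

lemma less_quad: "z \<prec> x \<Longrightarrow> x \<prec> quad x"
  unfolding quad_def using less_double double_pos less_trans by blast

lemma quad_pos: "z \<prec> x \<Longrightarrow> z \<prec> quad x"
  unfolding quad_def by (intro double_pos)

lemma double_less: "x \<prec> y \<Longrightarrow> double x \<prec> double y"
  unfolding double_def by (rule plus_less_mono)

lemma quad_less: "x \<prec> y \<Longrightarrow> quad x \<prec> quad y"
  unfolding quad_def by (intro double_less)

lemma quad_times: "x \<in> K \<Longrightarrow> quad x = quad u \<^bold>* x"
proof -
  have *: "double y \<^bold>* w = double (y \<^bold>* w)" if "y \<in> K" "w \<in> K" for y w
    using that by (simp add: double_def distrib)
  assume "x \<in> K"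
  then show ?thesis using one_in_K by (simp add: quad_def * one_times)
qed

text \<open>
  This identity links the order-reversing involution \<open>recip\<close> to the map \<open>x \<mapsto> 4 x\<close>. It makes
  \<open>recip (quad (recip y))\<close> a quarter of \<open>y\<close>.
\<close>

lemma quad_recip_quad: "z \<prec> x \<Longrightarrow> quad (recip (quad x)) = recip x"
proof -
  assume x: "z \<prec> x"
  then have K: "x \<in> K" "x \<noteq> z" using less_in_K by auto
  have q: "quad x \<noteq> z" using quad_pos[OF x] by auto
  let ?w = "recip (quad x)"
  have "x \<^bold>* quad ?w = (quad u \<^bold>* x) \<^bold>* ?w"
    using K quad_times[of ?w] times_comm[of x "quad u"] by (simp flip: times_assoc)
  also have "\<dots> = u"
    using times_recip[OF quad_closed q] by (simp only: quad_times[OF K(1), symmetric])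
  finally show ?thesis using recip_eq_iff[OF K, of "quad ?w"] by simp
qed

text \<open>
  Leastness of the supremum in contrapositive form, as the arguments with \<open>m / 4\<close> below require it.
\<close>

lemma supremum:
  assumes "elts E S \<subseteq> K" "s0 \<in> elts E S" "b \<in> K" "\<And>s. s \<in> elts E S \<Longrightarrow> s \<preceq> b"
  shows "\<exists>m\<in>K. (\<forall>s\<in>elts E S. s \<preceq> m) \<and> (\<forall>c\<in>K. c \<prec> m \<longrightarrow> (\<exists>s\<in>elts E S. c \<prec> s))"
proof -
  have le: "rel_in E rle s c \<longleftrightarrow> s \<preceq> c" if "s \<in> elts E S" "c \<in> K" for s c
    using rle_iff that assms(1) by blast
  obtain m where m: "m \<in> K" "\<forall>s\<in>elts E S. rel_in E rle s m"
    "\<forall>c\<in>K. (\<forall>s\<in>elts E S. rel_in E rle s c) \<longrightarrow> rel_in E rle m c"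
    using rle_complete[OF assms(1)] assms(2-4) le by blast
  have "\<exists>s\<in>elts E S. c \<prec> s" if "c \<in> K" "c \<prec> m" for c
  proof (rule ccontr)
    assume "\<not> (\<exists>s\<in>elts E S. c \<prec> s)"
    then have "\<forall>s\<in>elts E S. s \<preceq> c" using not_less that(1) assms(1) by blast
    then have "m \<preceq> c" using m(1,3) le rle_iff that(1) by blast
    then show False using that(2) less_asym unfolding less_eq_def by blast
  qed
  with m le show ?thesis by blast
qed

lemma definable_less [definable]:
  "definable_term E x \<Longrightarrow> definable_term E y \<Longrightarrow> definable E (\<lambda>v. x v \<prec> y v)"
  unfolding less_def by (intro definable)

lemma definable_less_eq [definable]:
  "definable_term E x \<Longrightarrow> definable_term E y \<Longrightarrow> definable E (\<lambda>v. x v \<preceq> y v)"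
  unfolding less_eq_def by (intro definable)

lemma definable_plus [definable]:
  "definable_term E x \<Longrightarrow> definable_term E y \<Longrightarrow> definable_term E (\<lambda>v. x v \<^bold>+ y v)"
proof (rule definable_term2[where f = "(\<^bold>+)"])
  have "s = x \<^bold>+ y \<longleftrightarrow> (x \<in> K \<and> y \<in> K \<and> rel_in E radd (pair_in E x y) s) \<or>
      (\<not> (x \<in> K \<and> y \<in> K) \<and> s = z)" for s x y
    using rel_in_app_iff[OF radd_function, of "pair_in E x y" s]
    by (auto simp: plus_def pair_in_times)
  then show "definable E (\<lambda>v. v 0 = v 1 \<^bold>+ v 2)" by (simp only:) (intro definable)
qed

lemma definable_neg [definable]:
  "definable_term E x \<Longrightarrow> definable_term E (\<lambda>v. neg (x v))"
proof (rule definable_term1[where f = neg])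
  have "y = neg x \<longleftrightarrow> (x \<in> K \<and> y \<in> K \<and> y \<^bold>+ x = z) \<or> (x \<notin> K \<and> y = z)" for x y
    using neg_eq_iff[of x y] by (auto simp: neg_def)
  then show "definable E (\<lambda>v. v 0 = neg (v 1))" by (simp only:) (intro definable)
qed

lemma definable_recip [definable]:
  "definable_term E x \<Longrightarrow> definable_term E (\<lambda>v. recip (x v))"
proof (rule definable_term1[where f = recip])
  have "y = recip x \<longleftrightarrow> (x \<in> K \<and> x \<noteq> z \<and> y \<in> K \<and> rel_in E rmul (pair_in E x y) u) \<or>
      (\<not> (x \<in> K \<and> x \<noteq> z) \<and> y = z)" for x y
  proof (cases "x \<in> K \<and> x \<noteq> z")
    case True
    have "rel_in E rmul (pair_in E x y) u \<longleftrightarrow> x \<^bold>* y = u" if "y \<in> K"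
      using rel_in_app_iff[OF rmul_function, of "pair_in E x y" u] True that
      by (simp add: times_def pair_in_times)
    then show ?thesis using recip_eq_iff[of x y] True by blast
  next
    case False
    then show ?thesis by (auto simp: recip_def)
  qed
  then show "definable E (\<lambda>v. v 0 = recip (v 1))" by (simp only:) (intro definable)
qed

lemma definable_double [definable]:
  "definable_term E x \<Longrightarrow> definable_term E (\<lambda>v. double (x v))"
  unfolding double_def by (intro definable)

lemma definable_quad [definable]:
  "definable_term E x \<Longrightarrow> definable_term E (\<lambda>v. quad (x v))"
  unfolding quad_def by (intro definable)

section \<open>Sums of one and two terms\<close>

lemma op_radd: "x \<in> K \<Longrightarrow> y \<in> K \<Longrightarrow> op_in E radd x y = x \<^bold>+ y"
  by (simp add: plus_def)

text \<open>
  The argument refers to sums of one or two terms. In both lemmas the bijection and the sequence of partial sums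
  demanded by \<open>finite_sum_in\<close> are given by case distinctions on the numerals 0, 1, 2 of the model.
\<close>

lemma singleton_sum:
  assumes X: "elts E X \<subseteq> K" and a: "a \<in> elts E X"
  shows "a \<in> FS_in E R radd z X"
proof -
  let ?zero = "empty_in E" let ?one = "succ_in E ?zero"
  have aK: "a \<in> K" using assms by blast
  have e1: "elts E ?one = {?zero}" by (simp add: elts_succ elts_empty)
  have e2: "elts E (succ_in E ?one) = {?one, ?zero}" by (simp add: elts_succ elts_empty)
  obtain F where F: "elts E F = {a}" using singleton by blast
  have "\<exists>f. function_in E f (elts E ?one) (elts E F) \<and> (\<forall>k\<in>elts E ?one. app_in E f k = a)"
    by (rule function_of_term[where t = "\<lambda>_. a"]) (intro definable, simp add: F)
  then obtain f where f: "function_in E f (elts E ?one) (elts E F)" "app_in E f ?zero = a"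
    by (auto simp: e1)
  have "\<exists>g. function_in E g (elts E (succ_in E ?one)) K \<and>
      (\<forall>k\<in>elts E (succ_in E ?one). app_in E g k = (if k = ?zero then z else a))"
    by (rule function_of_term[where t = "\<lambda>k. if k = ?zero then z else a"])
       (intro definable, simp add: zero_in_K aK)
  then obtain g where g: "function_in E g (elts E (succ_in E ?one)) K"
      "app_in E g ?zero = z" "app_in E g ?one = a"
    by (auto simp: e2 succ_not_empty)
  have "finite_sum_in E R radd z F a"
    unfolding finite_sum_in_def
  proof (intro bexI exI conjI)
    show "bij_betw (app_in E f) (elts E ?one) (elts E F)" using f by (simp add: e1 F bij_betw_def)
    show "\<forall>k\<in>elts E ?one. app_in E g (succ_in E k) = op_in E radd (app_in E g k) (app_in E f k)"
      using f g aK by (simp add: e1 op_radd zero_in_K zero_plus)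
  qed (use f g in \<open>simp_all add: succ_in_omega empty_in_omega\<close>)
  with F a show ?thesis unfolding FS_in_def by auto
qed

lemma doubleton_sum:
  assumes X: "elts E X \<subseteq> K" and ab: "a \<in> elts E X" "b \<in> elts E X" "a \<noteq> b"
  shows "a \<^bold>+ b \<in> FS_in E R radd z X"
proof -
  let ?zero = "empty_in E" let ?one = "succ_in E ?zero" let ?two = "succ_in E ?one"
  have K: "a \<in> K" "b \<in> K" using assms by blast+
  have ne: "?one \<noteq> ?zero" "?two \<noteq> ?zero" "?two \<noteq> ?one" by (simp_all add: succ_not_empty succ_inject)
  have e2: "elts E ?two = {?one, ?zero}" by (simp add: elts_succ elts_empty)
  have e3: "elts E (succ_in E ?two) = {?two, ?one, ?zero}" by (simp add: elts_succ elts_empty)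
  obtain F where F: "elts E F = {a, b}" using doubleton by blast
  have "\<exists>f. function_in E f (elts E ?two) (elts E F) \<and>
      (\<forall>k\<in>elts E ?two. app_in E f k = (if k = ?zero then a else b))"
    by (rule function_of_term[where t = "\<lambda>k. if k = ?zero then a else b"]) (intro definable, simp add: F)
  then obtain f where f: "function_in E f (elts E ?two) (elts E F)"
      "app_in E f ?zero = a" "app_in E f ?one = b"
    using ne by (auto simp: e2)
  have "\<exists>g. function_in E g (elts E (succ_in E ?two)) K \<and>
      (\<forall>k\<in>elts E (succ_in E ?two). app_in E g k = (if k = ?zero then z else if k = ?one then a else a \<^bold>+ b))"
    by (rule function_of_term[where t = "\<lambda>k. if k = ?zero then z else if k = ?one then a else a \<^bold>+ b"])
       (intro definable, simp add: zero_in_K K)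
  then obtain g where g: "function_in E g (elts E (succ_in E ?two)) K"
      "app_in E g ?zero = z" "app_in E g ?one = a" "app_in E g ?two = a \<^bold>+ b"
    using ne by (auto simp: e3)
  have "finite_sum_in E R radd z F (a \<^bold>+ b)"
    unfolding finite_sum_in_def
  proof (intro bexI exI conjI)
    show "bij_betw (app_in E f) (elts E ?two) (elts E F)"
      using f ne ab(3) by (auto simp: e2 F bij_betw_def inj_on_def)
    show "\<forall>k\<in>elts E ?two. app_in E g (succ_in E k) = op_in E radd (app_in E g k) (app_in E f k)"
      using f g K by (simp add: e2 op_radd zero_in_K zero_plus)
  qed (use f g in \<open>simp_all add: succ_in_omega empty_in_omega\<close>)
  with F ab show ?thesis unfolding FS_in_def by auto
qed

section \<open>Powers of four\<close>

text \<open>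
  Starting from 1, iteration of \<open>reflect\<close> runs through 1, 4, 1/4, 16, 1/16, and so on: all powers of 4 with
  integer exponents are produced by one map.
\<close>

definition reflect :: "'m \<Rightarrow> 'm" where
  "reflect m = (if u \<prec> m then recip m else quad (recip m))"

text \<open>
  Starting from 0, iteration of \<open>spiral\<close> runs through 0, 1, -1, 4, -4, 1/4, -1/4, and so on. Enumerating
  zero and the powers of both signs by one injective map makes
  the set of labels an orbit, so that its countability is an instance of \<open>orbit_countable\<close>.
\<close>

definition spiral :: "'m \<Rightarrow> 'm" where
  "spiral p = (if p = z then u else if z \<prec> p then neg p else reflect (neg p))"

lemma definable_reflect [definable]:
  "definable_term E x \<Longrightarrow> definable_term E (\<lambda>v. reflect (x v))"
  unfolding reflect_def by (intro definable)

lemma definable_spiral [definable]: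
  "definable_term E x \<Longrightarrow> definable_term E (\<lambda>v. spiral (x v))"
  unfolding spiral_def by (intro definable)

lemma reflect_pos: "z \<prec> m \<Longrightarrow> z \<prec> reflect m"
  by (simp add: reflect_def recip_pos quad_pos)

lemma recip_less_one: "u \<prec> m \<Longrightarrow> recip m \<prec> u"
  using recip_less[OF one_pos] recip_one by metis

lemma one_less_eq_recip: "z \<prec> m \<Longrightarrow> m \<preceq> u \<Longrightarrow> u \<preceq> recip m"
  unfolding less_eq_def using recip_less[of m u] recip_one by metis

lemma one_less_quad_recip: "z \<prec> m \<Longrightarrow> \<not> u \<prec> m \<Longrightarrow> u \<prec> quad (recip m)"
  using one_less_eq_recip[of m] less_quad[OF recip_pos, of m] not_less[OF one_in_K, of m] less_in_K
    le_less_trans by blast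

lemma reflect_not_one: "z \<prec> m \<Longrightarrow> reflect m \<noteq> u"
  using recip_less_one[of m] one_less_quad_recip[of m] less_irrefl[of u] by (auto simp: reflect_def)

lemma quad_less_iff: "x \<in> K \<Longrightarrow> y \<in> K \<Longrightarrow> quad x \<prec> quad y \<longleftrightarrow> x \<prec> y"
  using quad_less not_less[of x y] less_asym unfolding less_eq_def by blast

lemma quad_inject: "x \<in> K \<Longrightarrow> y \<in> K \<Longrightarrow> quad x = quad y \<longleftrightarrow> x = y"
  using quad_less_iff[of x y] quad_less_iff[of y x] not_less[of x y] unfolding less_eq_def by auto

lemma recip_inject: "z \<prec> x \<Longrightarrow> z \<prec> y \<Longrightarrow> recip x = recip y \<longleftrightarrow> x = y"
  using recip_recip by metis

lemma reflect_inject: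
  assumes "z \<prec> x" "z \<prec> y" "reflect x = reflect y"
  shows "x = y"
proof -
  have "u \<prec> m \<longleftrightarrow> reflect m \<prec> u" if "z \<prec> m" for m
    using recip_less_one one_less_quad_recip[OF that] less_asym by (auto simp: reflect_def)
  then have "u \<prec> x \<longleftrightarrow> u \<prec> y" using assms by metis
  then show ?thesis
    using assms by (auto simp: reflect_def quad_inject recip_inject split: if_splits)
qed

lemma spiral_inject:
  assumes "x \<in> K" "y \<in> K" "spiral x = spiral y"
  shows "x = y"
proof -
  have z: "spiral x = u \<longleftrightarrow> x = z" if "x \<in> K" for x
    using that one_pos neg_pos[of x] reflect_not_one[of "neg x"] not_less[OF zero_in_K that] less_asym[of z]
    by (auto simp: spiral_def less_eq_def dest: sym)
  have n: "spiral x \<prec> z \<longleftrightarrow> z \<prec> x" if "x \<in> K" for x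
    using that one_pos neg_pos[of x] neg_pos[of "neg x"] neg_neg[of x] reflect_pos[of "neg x"]
      not_less[OF zero_in_K that] less_asym[of z]
    by (auto simp: spiral_def less_eq_def)
  consider "x = z" | "z \<prec> x" | "x \<noteq> z" "\<not> z \<prec> x" by blast
  then show ?thesis
  proof cases
    case 1
    then show ?thesis using z assms by metis
  next
    case 2
    then have "z \<prec> y" using n assms by metis
    then show ?thesis using 2 assms neg_neg by (metis spiral_def less_irrefl)
  next
    case 3
    then have "y \<noteq> z" "\<not> z \<prec> y" using n z assms by metis+
    moreover from this 3 have "z \<prec> neg x" "z \<prec> neg y"
      using neg_pos not_less[OF zero_in_K] assms unfolding less_eq_def by metis+
    ultimately have "neg x = neg y" using 3 assms(3) reflect_inject by (simp add: spiral_def)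
    then show ?thesis using neg_neg assms by metis
  qed
qed

lemma spiral_nonzero: "x \<in> K \<Longrightarrow> spiral x \<noteq> z"
  using one_pos neg_neg[of x] neg_zero neg_pos[of x] reflect_pos[of "neg x"] not_less[OF zero_in_K, of x]
  by (auto simp: spiral_def less_eq_def)

text \<open>
  Division by 4, written with \<open>recip\<close> so that closure of the powers of 4 under it is immediate.
\<close>

definition unquad :: "'m \<Rightarrow> 'm" where "unquad x = recip (quad (recip x))"

lemma unquad_pos: "z \<prec> x \<Longrightarrow> z \<prec> unquad x"
  unfolding unquad_def by (intro recip_pos quad_pos)

lemma quad_unquad: "z \<prec> x \<Longrightarrow> quad (unquad x) = x"
  unfolding unquad_def by (simp add: quad_recip_quad recip_pos recip_recip)

lemma unquad_less: "z \<prec> x \<Longrightarrow> unquad x \<prec> x"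
  using less_quad[OF unquad_pos, of x] quad_unquad by simp

text \<open>
  Powers of 4 are spaced by a factor 4: for them this relation will turn out to be empty.
\<close>

definition near :: "'m \<Rightarrow> 'm \<Rightarrow> bool" where
  "near p q \<longleftrightarrow> p \<prec> q \<and> q \<prec> quad p"

lemma near_recip:
  assumes "z \<prec> p" "z \<prec> q" "near (recip p) q"
  shows "near (recip q) p"
proof -
  have "recip q \<prec> recip (recip p)"
    using assms recip_pos by (auto simp: near_def intro: recip_less)
  moreover have "quad (recip (quad (recip p))) \<prec> quad (recip q)"
    using assms by (auto simp: near_def intro: recip_less quad_less)
  ultimately show ?thesis
    using assms(1) by (simp add: near_def quad_recip_quad recip_pos recip_recip)
qed

lemma near_quad: "p \<in> K \<Longrightarrow> q \<in> K \<Longrightarrow> near (quad p) (quad q) \<longleftrightarrow> near p q"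
  by (simp add: near_def quad_less_iff)

lemma definable_near [definable]:
  "definable_term E x \<Longrightarrow> definable_term E y \<Longrightarrow> definable E (\<lambda>v. near (x v) (y v))"
  unfolding near_def by (intro definable)

end

text \<open>
  \<open>Pw\<close> is the set of powers of 4 with integer exponents and \<open>Lb\<close> the set consisting of 0 and the powers of both
  signs.
\<close>

locale model_powers = model_reals E R radd rmul rle z u
  for E :: "'m \<Rightarrow> 'm \<Rightarrow> bool" and R radd rmul rle z u +
  fixes Pw Lb :: 'm
  assumes powers_orbit: "orbit E reflect u Pw" and labels_orbit: "orbit E spiral z Lb"
begin

abbreviation "powers \<equiv> elts E Pw"
abbreviation "labels \<equiv> elts E Lb"

lemma powers_pos: "m \<in> powers \<Longrightarrow> z \<prec> m"
  by (rule orbit_induct[OF powers_orbit, where P = "\<lambda>m. z \<prec> m"], intro definable)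
     (auto simp: one_pos reflect_pos)

lemma powers_in_K: "m \<in> powers \<Longrightarrow> m \<in> K"
  using powers_pos less_in_K by blast

lemma powers_cases:
  assumes "m \<in> powers"
  obtains "m = u" | m' where "m' \<in> powers" "m = reflect m'"
proof -
  have "m = u \<or> (\<exists>m'\<in>powers. m = reflect m')"
    by (rule orbit_induct[OF powers_orbit _ _ _ assms, where P = "\<lambda>m. m = u \<or> (\<exists>m'\<in>powers. m = reflect m')"])
       (intro definable, auto)
  then show ?thesis using that by blast
qed

lemma one_in_powers: "u \<in> powers" by (rule least_closed_base[OF powers_orbit])

text \<open>
  An element below 1 can only have been produced as the reciprocal of an element above 1.
\<close>

lemma recip_in_powers:
  assumes "m \<in> powers"
  shows "recip m \<in> powers"
proof (cases "u \<prec> m")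
  case True
  then show ?thesis using orbit_step[OF powers_orbit assms] by (simp add: reflect_def)
next
  case False
  from assms show ?thesis
  proof (cases rule: powers_cases)
    case 1
    then show ?thesis using one_in_powers recip_one by simp
  next
    case (2 m')
    with False have "u \<prec> m'"
      using one_less_quad_recip[OF powers_pos, of m'] by (auto simp: reflect_def split: if_splits)
    then show ?thesis using 2 powers_pos by (simp add: reflect_def recip_recip)
  qed
qed

text \<open>
  For \<open>m \<ge> 1\<close> the map \<open>reflect\<close> leads from \<open>recip m\<close> to \<open>quad m\<close>. For \<open>m < 1\<close> the element \<open>recip m > 1\<close> was
  itself produced by \<open>reflect\<close>, and what it was produced from is \<open>quad m\<close>.
\<close>

lemma quad_in_powers:
  assumes "m \<in> powers"
  shows "quad m \<in> powers"
proof (cases "u \<prec> recip m")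
  case False
  then show ?thesis
    using orbit_step[OF powers_orbit recip_in_powers[OF assms]] powers_pos[OF assms]
    by (simp add: reflect_def recip_recip)
next
  case True
  from recip_in_powers[OF assms] show ?thesis
  proof (cases rule: powers_cases)
    case 1
    then show ?thesis using True by simp
  next
    case (2 w)
    have "\<not> u \<prec> w"
      using 2(2) True recip_less_one[of w] less_asym[of u "recip w"] by (auto simp: reflect_def)
    then have "m = recip (quad (recip w))"
      using 2 recip_recip[OF powers_pos[OF assms]] by (simp add: reflect_def)
    then have "quad m = w"
      using quad_recip_quad[OF recip_pos, of w] recip_recip[of w] powers_pos[OF 2(1)] by simp
    then show ?thesis using 2 by simp
  qed
qed

lemma unquad_in_powers: "m \<in> powers \<Longrightarrow> unquad m \<in> powers"
  unfolding unquad_def by (intro recip_in_powers quad_in_powers)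

lemma not_near_one: "q \<in> powers \<Longrightarrow> \<not> near u q \<and> \<not> near q u"
proof (rule orbit_induct[OF powers_orbit, where P = "\<lambda>q. \<not> near u q \<and> \<not> near q u"])
  show "definable E (\<lambda>v. \<not> near u (v 0) \<and> \<not> near (v 0) u)" by (intro definable)
  show "\<not> near u u \<and> \<not> near u u" by (simp add: near_def)
next
  fix q assume "q \<in> powers" and IH: "\<not> near u q \<and> \<not> near q u"
  then have q: "z \<prec> q" using powers_pos by blast
  show "\<not> near u (reflect q) \<and> \<not> near (reflect q) u"
  proof (cases "u \<prec> q")
    case True
    then show ?thesis
      using IH near_recip[OF q one_pos] near_recip[OF one_pos recip_pos[OF q]] recip_one recip_recip[OF q]
      by (auto simp: reflect_def)
  next
    case False
    then have "\<not> recip q \<prec> u"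
      using one_less_eq_recip[OF q] not_less[OF one_in_K, of q] less_in_K[OF q] less_le_not_le by blast
    moreover have "u \<prec> quad (recip q)" by (rule one_less_quad_recip[OF q False])
    ultimately show ?thesis using False less_asym quad_less_iff one_in_K
      by (auto simp: reflect_def near_def)
  qed
qed

text \<open>
  Induction on \<open>p\<close>. By \<open>near_recip\<close> and \<open>near_quad\<close> the relation \<open>near\<close> is reversed by \<open>recip\<close> and
  preserved by \<open>quad\<close>, and both are permutations of the set of powers, so the property passes from \<open>p\<close> to
  \<open>recip p\<close> and to \<open>quad p\<close>.
\<close>

lemma not_near:
  assumes "p \<in> powers" "q \<in> powers"
  shows "\<not> near p q"
proof -
  let ?D = "\<lambda>p. \<forall>q\<in>powers. \<not> near p q \<and> \<not> near q p"
  have recip: "?D (recip p)" if p: "p \<in> powers" "?D p" for p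
  proof (intro ballI conjI notI)
    fix q assume q: "q \<in> powers"
    have r: "recip q \<in> powers" by (rule recip_in_powers[OF q])
    show False if "near (recip p) q"
      using near_recip[OF powers_pos powers_pos that] p q r by blast
    have "q = recip (recip q)" using recip_recip powers_pos q by metis
    then show False if "near q (recip p)"
      using near_recip[OF powers_pos[OF r] recip_pos[OF powers_pos[OF p(1)]]] that p r recip_recip powers_pos by metis
  qed
  have quad: "?D (quad p)" if p: "p \<in> powers" "?D p" for p
  proof -
    have "\<not> near (quad p) (quad (unquad q)) \<and> \<not> near (quad (unquad q)) (quad p)" if "q \<in> powers" for q
      using near_quad p unquad_in_powers[OF that] powers_in_K by metis
    then show ?thesis using quad_unquad powers_pos by metis
  qed
  have "?D p"
  proof (rule orbit_induct[OF powers_orbit _ _ _ assms(1), where P = ?D])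
    show "definable E (\<lambda>v. ?D (v 0))" by (intro definable)
    show "?D u" using not_near_one by blast
    show "?D (reflect p)" if "p \<in> powers" "?D p" for p
      using recip[OF that] quad[OF recip_in_powers[OF that(1)]] by (simp add: reflect_def)
  qed
  then show ?thesis using assms(2) by blast
qed

text \<open>
  If the powers were bounded, let \<open>m\<close> be their supremum. Some power exceeds \<open>m / 4\<close>, and four times that power is
  a power exceeding \<open>m\<close>.
\<close>

lemma powers_unbounded:
  assumes "x \<in> K"
  shows "\<exists>p\<in>powers. x \<prec> p"
proof (rule ccontr)
  assume "\<not> (\<exists>p\<in>powers. x \<prec> p)"
  then have bound: "p \<preceq> x" if "p \<in> powers" for p using that not_less powers_in_K assms by blast
  have "\<exists>m\<in>K. (\<forall>p\<in>powers. p \<preceq> m) \<and> (\<forall>c\<in>K. c \<prec> m \<longrightarrow> (\<exists>p\<in>powers. c \<prec> p))"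
    by (rule supremum[of Pw u x]) (use powers_in_K one_in_powers assms bound in auto)
  then obtain m where m: "\<And>p. p \<in> powers \<Longrightarrow> p \<preceq> m" "\<And>c. c \<in> K \<Longrightarrow> c \<prec> m \<Longrightarrow> \<exists>p\<in>powers. c \<prec> p"
    by blast
  have "z \<prec> m" using m(1)[OF one_in_powers] one_pos less_le_trans by blast
  then obtain p where p: "p \<in> powers" "unquad m \<prec> p"
    using m(2) unquad_less less_in_K by blast
  then have "m \<prec> quad p" using quad_less quad_unquad \<open>z \<prec> m\<close> by metis
  then show False using m(1)[OF quad_in_powers[OF p(1)]] less_le_not_le by blast
qed

definition cell :: "'m \<Rightarrow> 'm \<Rightarrow> bool" where
  "cell p x \<longleftrightarrow> p \<in> powers \<and> p \<preceq> x \<and> x \<prec> quad p"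

text \<open>
  Let \<open>m\<close> be the supremum of the powers below \<open>x\<close>; a power \<open>p\<close> below \<open>x\<close> with \<open>p > m / 4\<close> satisfies
  \<open>quad p > m\<close>, so \<open>quad p\<close> exceeds \<open>x\<close>.
\<close>

lemma cell_exists:
  assumes x: "z \<prec> x"
  shows "\<exists>p. cell p x"
proof -
  \<comment> \<open>The set of powers below \<open>x\<close> is nonempty since the powers are unbounded above.\<close>
  obtain q where q: "q \<in> powers" "recip x \<prec> q" using powers_unbounded[OF recip_closed] by blast
  have r: "recip q \<preceq> x"
    using recip_less[OF recip_pos[OF x] q(2)] recip_recip[OF x] by (simp add: less_eq_def)
  have "\<exists>S. elts E S = {p \<in> powers. p \<preceq> x}" by (rule separation) (intro definable)
  then obtain S where S: "elts E S = {p \<in> powers. p \<preceq> x}" by blast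
  have "\<exists>m\<in>K. (\<forall>p\<in>elts E S. p \<preceq> m) \<and> (\<forall>c\<in>K. c \<prec> m \<longrightarrow> (\<exists>p\<in>elts E S. c \<prec> p))"
    by (rule supremum[of S "recip q" x])
       (use S powers_in_K recip_in_powers[OF q(1)] r less_in_K[OF x] in auto)
  then obtain m where m: "\<And>p. p \<in> elts E S \<Longrightarrow> p \<preceq> m"
      "\<And>c. c \<in> K \<Longrightarrow> c \<prec> m \<Longrightarrow> \<exists>p\<in>elts E S. c \<prec> p"
    by blast
  have "z \<prec> m"
    using m(1)[of "recip q"] S recip_in_powers[OF q(1)] r powers_pos less_le_trans by blast
  then obtain p where p: "p \<in> elts E S" "unquad m \<prec> p"
    using m(2) unquad_less less_in_K by blast
  then have "m \<prec> quad p" using quad_less quad_unquad \<open>z \<prec> m\<close> by metis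
  then have "quad p \<notin> elts E S" using m(1) less_le_not_le by blast
  then have "\<not> quad p \<preceq> x" using S p(1) quad_in_powers by blast
  then have "x \<prec> quad p" using not_less less_in_K[OF x] by (metis quad_closed)
  then show ?thesis using S p(1) unfolding cell_def by blast
qed

lemma cell_unique: "cell p x \<Longrightarrow> cell q x \<Longrightarrow> p = q"
proof -
  have "\<not> p \<prec> q" if "cell p x" "cell q x" for p q
    using that not_near[of p q] le_less_trans[of q x "quad p"] unfolding cell_def near_def by blast
  moreover assume "cell p x" "cell q x"
  ultimately show "p = q"
    using not_less[of p q] powers_in_K[of p] powers_in_K[of q] unfolding cell_def less_eq_def by metis
qed

section \<open>The colouring\<close>

text \<open>
  The cell \<open>[p, 4 p)\<close> of a positive number is divided into the lower half \<open>[p, 2 p)\<close> and the upper half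
  \<open>[2 p, 4 p)\<close>.
\<close>

definition low :: "'m \<Rightarrow> bool" where
  "low x \<longleftrightarrow> (\<exists>p\<in>powers. p \<preceq> x \<and> x \<prec> double p)"

text \<open>
  The colour depends on the absolute value only, since \<open>low\<close> fails for the negative one of \<open>x\<close> and \<open>neg x\<close>.
\<close>

definition coloured :: "'m \<Rightarrow> bool" where
  "coloured x \<longleftrightarrow> low x \<or> low (neg x)"

lemma low_in_cell: "cell p x \<Longrightarrow> low x \<longleftrightarrow> x \<prec> double p"
proof -
  assume p: "cell p x"
  have "cell q x" if "q \<in> powers" "q \<preceq> x" "x \<prec> double q" for q
    using that less_trans[OF that(3) less_double[OF double_pos[OF powers_pos[OF that(1)]]]]
    unfolding cell_def quad_def by blast
  then show ?thesis using p cell_unique unfolding low_def cell_def by blast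
qed

text \<open>
  The sum of two numbers in \<open>[p, 2 p)\<close> lies in \<open>[2 p, 4 p)\<close>, and the sum of two numbers in \<open>[2 p, 4 p)\<close> lies
  in \<open>[4 p, 8 p)\<close>, the lower half of the next cell.
\<close>

lemma low_sum:
  assumes a: "cell p a" and b: "cell p b" and ab: "low a \<longleftrightarrow> low b"
  shows "low (a \<^bold>+ b) \<longleftrightarrow> \<not> low a"
proof (cases "low a")
  case True
  then have "a \<prec> double p" "b \<prec> double p" using low_in_cell a b ab by blast+
  then have "a \<^bold>+ b \<prec> quad p" unfolding quad_def double_def[of "double p"] by (rule plus_less_mono)
  moreover have "double p \<preceq> a \<^bold>+ b"
    unfolding double_def using a b \<open>a \<prec> double p\<close> \<open>b \<prec> double p\<close> less_in_K
    by (intro plus_mono) (auto simp: cell_def)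
  moreover have "p \<prec> double p" using a powers_pos less_double by (auto simp: cell_def)
  ultimately have "cell p (a \<^bold>+ b)" "\<not> a \<^bold>+ b \<prec> double p"
    using a less_le_trans less_le_not_le unfolding cell_def less_eq_def by blast+
  then show ?thesis using low_in_cell True by blast
next
  case False
  have K: "a \<in> K" "b \<in> K" using a b less_in_K unfolding cell_def by blast+
  have "double p \<preceq> a" "double p \<preceq> b"
    using False ab low_in_cell[OF a] low_in_cell[OF b] not_less[OF K(1) double_closed]
      not_less[OF K(2) double_closed] by blast+
  then have "quad p \<preceq> a \<^bold>+ b" unfolding quad_def double_def[of "double p"]
    using K by (intro plus_mono)
  moreover have "a \<^bold>+ b \<prec> double (quad p)"
    unfolding double_def[of "quad p"] using a b by (intro plus_less_mono) (auto simp: cell_def)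
  ultimately have "low (a \<^bold>+ b)" unfolding low_def using a quad_in_powers by (auto simp: cell_def)
  then show ?thesis using False by blast
qed

lemma low_pos: "low x \<Longrightarrow> z \<prec> x"
  unfolding low_def using powers_pos less_le_trans by blast

lemma coloured_pos: "z \<prec> x \<Longrightarrow> coloured x \<longleftrightarrow> low x"
  unfolding coloured_def using low_pos neg_pos less_asym by blast

lemma coloured_neg: "x \<in> K \<Longrightarrow> coloured (neg x) \<longleftrightarrow> coloured x"
  unfolding coloured_def using neg_neg by auto

lemma cell_pos: "cell p x \<Longrightarrow> z \<prec> x"
  unfolding cell_def using powers_pos less_le_trans by blast

lemma coloured_sum_pos:
  assumes "cell p a" "cell p b" "coloured a \<longleftrightarrow> coloured b"
  shows "coloured (a \<^bold>+ b) \<longleftrightarrow> \<not> coloured a"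
proof -
  have pos: "z \<prec> a" "z \<prec> b" using assms cell_pos by blast+
  then have "z \<prec> a \<^bold>+ b" using plus_less_mono[OF pos] zero_plus zero_in_K by simp
  then show ?thesis using low_sum[OF assms(1,2)] assms(3) coloured_pos pos by simp
qed

definition label :: "'m \<Rightarrow> 'm \<Rightarrow> bool" where
  "label x p \<longleftrightarrow> (x = z \<and> p = z) \<or> (z \<prec> x \<and> cell p x) \<or> (x \<prec> z \<and> cell (neg p) (neg x))"

text \<open>
  Numbers with a common label are of the same sign; for two negative numbers the claim is about their
  opposites.
\<close>

lemma coloured_sum:
  assumes K: "a \<in> K" "b \<in> K" and "a \<noteq> b" and lab: "label a p" "label b p"
    and ab: "coloured a \<longleftrightarrow> coloured b"
  shows "coloured (a \<^bold>+ b) \<longleftrightarrow> \<not> coloured a"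
proof -
  have "\<not> (cell p x \<and> cell (neg p) y)" for x y
    using powers_pos[of p] powers_pos[of "neg p"] neg_pos less_asym unfolding cell_def by blast
  moreover have "\<not> cell z x" "\<not> cell (neg z) x" for x
    using powers_pos[of z] neg_zero unfolding cell_def by auto
  ultimately consider "cell p a" "cell p b" | "cell (neg p) (neg a)" "cell (neg p) (neg b)"
    using lab assms(3) unfolding label_def by metis
  then show ?thesis
  proof cases
    case 1
    then show ?thesis using ab by (rule coloured_sum_pos)
  next
    case 2
    then have "coloured (neg a \<^bold>+ neg b) \<longleftrightarrow> \<not> coloured (neg a)"
      using ab coloured_neg K by (intro coloured_sum_pos) auto
    then show ?thesis
      using K coloured_neg[of "a \<^bold>+ b"] coloured_neg[of a] by (simp add: neg_plus)
  qed
qed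

lemma zero_in_labels: "z \<in> labels" by (rule least_closed_base[OF labels_orbit])

lemma labels_in_K: "p \<in> labels \<Longrightarrow> p \<in> K"
proof (rule orbit_induct[OF labels_orbit, where P = "\<lambda>p. p \<in> K"])
  show "definable E (\<lambda>v. v 0 \<in> K)" by (intro definable)
qed (auto simp: zero_in_K one_in_K spiral_def reflect_def)

lemma powers_in_labels: "m \<in> powers \<Longrightarrow> m \<in> labels \<and> neg m \<in> labels"
proof (rule orbit_induct[OF powers_orbit, where P = "\<lambda>m. m \<in> labels \<and> neg m \<in> labels"])
  show "definable E (\<lambda>v. v 0 \<in> labels \<and> neg (v 0) \<in> labels)" by (intro definable)
  have neg: "spiral m = neg m" if "z \<prec> m" for m using that by (auto simp: spiral_def)
  have "spiral z = u" by (simp add: spiral_def)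
  then have "u \<in> labels" using orbit_step[OF labels_orbit zero_in_labels] by simp
  then show "u \<in> labels \<and> neg u \<in> labels" using orbit_step[OF labels_orbit, of u] neg[OF one_pos] by simp
  fix m assume m: "m \<in> powers" and "m \<in> labels \<and> neg m \<in> labels"
  have "neg m \<prec> z" using powers_pos[OF m] neg_pos[of "neg m"] neg_neg powers_in_K[OF m] by simp
  then have "spiral (neg m) = reflect m"
    using neg_neg powers_in_K[OF m] less_asym by (auto simp: spiral_def)
  then have "reflect m \<in> labels" using orbit_step[OF labels_orbit, of "neg m"] \<open>m \<in> labels \<and> neg m \<in> labels\<close> by simp
  then show "reflect m \<in> labels \<and> neg (reflect m) \<in> labels"
    using orbit_step[OF labels_orbit, of "reflect m"] neg reflect_pos powers_pos[OF m] by simp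
qed

lemma label_ex1:
  assumes "x \<in> K"
  shows "\<exists>!p. p \<in> labels \<and> label x p"
proof -
  consider "x = z" | "z \<prec> x" | "x \<prec> z"
    using not_less[OF zero_in_K assms] unfolding less_eq_def by blast
  then show ?thesis
  proof cases
    case 1
    then show ?thesis using zero_in_labels by (auto simp: label_def)
  next
    case 2
    then have "label x p \<longleftrightarrow> cell p x" for p using less_asym by (auto simp: label_def)
    moreover obtain p where "cell p x" using cell_exists 2 by blast
    ultimately show ?thesis using cell_unique powers_in_labels unfolding cell_def by metis
  next
    case 3
    then have lab: "label x p \<longleftrightarrow> cell (neg p) (neg x)" for p using less_asym by (auto simp: label_def)
    obtain p where p: "cell p (neg x)" using cell_exists neg_pos 3 by blast
    then have pN: "p \<in> powers" by (simp add: cell_def)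
    show ?thesis
    proof (rule ex1I)
      show "neg p \<in> labels \<and> label x (neg p)"
        using p pN powers_in_labels lab neg_neg powers_in_K by metis
      show "q = neg p" if "q \<in> labels \<and> label x q" for q
        using that lab p cell_unique neg_neg labels_in_K by metis
    qed
  qed
qed

lemma labels_countable:
  "\<exists>c. function_in E c labels (omega_in E) \<and> inj_on (app_in E c) labels"
proof (rule orbit_countable[OF labels_orbit])
  show "definable E (\<lambda>v. v 0 = spiral (v 1))" by (intro definable)
  show "inj_on spiral labels" using spiral_inject labels_in_K by (auto simp: inj_on_def)
  show "z \<notin> spiral ` labels" using spiral_nonzero labels_in_K by (metis imageE)
qed

lemma definable_cell [definable]:
  "definable_term E p \<Longrightarrow> definable_term E x \<Longrightarrow> definable E (\<lambda>v. cell (p v) (x v))"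
  unfolding cell_def by (intro definable)

lemma definable_label [definable]:
  "definable_term E x \<Longrightarrow> definable_term E p \<Longrightarrow> definable E (\<lambda>v. label (x v) (p v))"
  unfolding label_def by (intro definable)

lemma definable_low: "definable_term E x \<Longrightarrow> definable E (\<lambda>v. low (x v))"
proof (rule definable_rel1[where P = low])
  show "definable E (\<lambda>v. low (v 0))" unfolding low_def by (intro definable)
qed

lemma definable_coloured [definable]:
  "definable_term E x \<Longrightarrow> definable E (\<lambda>v. coloured (x v))"
  unfolding coloured_def by (intro definable definable_low)

lemma countable_if_sums_coloured_alike:
  assumes X: "elts E X \<subseteq> K"
    and mono: "\<And>a b. a \<in> elts E X \<Longrightarrow> b \<in> elts E X \<Longrightarrow> a \<noteq> b \<Longrightarrow>
      (coloured a \<longleftrightarrow> coloured b) \<and> (coloured (a \<^bold>+ b) \<longleftrightarrow> coloured a)"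
  shows "\<not> uncountable_in E X"
proof -
  obtain c where c: "function_in E c labels (omega_in E)" "inj_on (app_in E c) labels"
    using labels_countable by blast
  show ?thesis
  proof (rule countable_if_labelled[OF c])
    show "definable E (\<lambda>v. label (v 0) (v 1))" by (intro definable)
    show "\<exists>!p. p \<in> labels \<and> label x p" if "x \<in> elts E X" for x using that X label_ex1 by blast
    show "a = b" if "a \<in> elts E X" "b \<in> elts E X" "label a p" "label b p" for a b p
      using that X coloured_sum[of a b p] mono[of a b] by blast
  qed
qed

text \<open>
  The colouring is \<open>coloured\<close>, made into a function of the model.
\<close>

lemma colouring_without_uncountable_monochromatic_sums:
  "\<exists>d. function_in E d K (two_in E) \<and>
     \<not> (\<exists>X. elts E X \<subseteq> K \<and> uncountable_in E X \<and> monochromatic_in E d (FS_in E R radd z X))"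
proof -
  let ?t = "\<lambda>x. if coloured x then empty_in E else succ_in E (empty_in E)"
  have "\<exists>d. function_in E d K (two_in E) \<and> (\<forall>x\<in>K. app_in E d x = ?t x)"
    by (rule function_of_term) (intro definable, simp add: two_in_def)
  then obtain d where d: "function_in E d K (two_in E)" "\<And>x. x \<in> K \<Longrightarrow> app_in E d x = ?t x" by blast
  have "\<not> uncountable_in E X"
    if X: "elts E X \<subseteq> K" and mono: "monochromatic_in E d (FS_in E R radd z X)" for X
  proof (rule countable_if_sums_coloured_alike[OF X])
    fix a b assume ab: "a \<in> elts E X" "b \<in> elts E X" "a \<noteq> b"
    obtain c where "\<forall>s\<in>FS_in E R radd z X. app_in E d s = c"
      using mono unfolding monochromatic_in_def by blast
    then have "app_in E d a = c" "app_in E d b = c" "app_in E d (a \<^bold>+ b) = c"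
      using singleton_sum[OF X] doubleton_sum[OF X] ab by blast+
    then have "?t a = c" "?t b = c" "?t (a \<^bold>+ b) = c" using d(2) X ab by auto
    then show "(coloured a \<longleftrightarrow> coloured b) \<and> (coloured (a \<^bold>+ b) \<longleftrightarrow> coloured a)"
      using succ_not_empty[of "empty_in E"] by (metis (full_types))
  qed
  with d(1) show ?thesis by blast
qed

end

text \<open>
  The positive reals are closed under \<open>reflect\<close>, and all reals under \<open>spiral\<close>.
\<close>

lemma (in model_reals) powers_exist: "\<exists>Pw Lb. model_powers E R radd rmul rle z u Pw Lb"
proof -
  have "\<exists>P. elts E P = {x \<in> K. z \<prec> x}" by (rule separation) (intro definable)
  then obtain P where P: "elts E P = {x \<in> K. z \<prec> x}" by blast
  have "\<exists>Pw. elts E Pw \<subseteq> elts E P \<and> orbit E reflect u Pw"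
  proof (rule least_closed_exists)
    show "definable E (\<lambda>v. v 1 = reflect (v 0))" by (intro definable)
  qed (use P one_pos one_in_K reflect_pos less_in_K in auto)
  moreover have "\<exists>Lb. elts E Lb \<subseteq> K \<and> orbit E spiral z Lb"
  proof (rule least_closed_exists)
    show "definable E (\<lambda>v. v 1 = spiral (v 0))" by (intro definable)
  qed (auto simp: zero_in_K one_in_K spiral_def reflect_def)
  ultimately show ?thesis
    by (metis model_powers.intro model_powers_axioms.intro model_reals_axioms)
qed

theorem corollary2p10:
  fixes E :: "'m \<Rightarrow> 'm \<Rightarrow> bool" and R radd rmul rle z u :: 'm
  assumes "ZF E"
    and "reals_in E R radd rmul rle z u"
  shows "\<exists>d. function_in E d (elts E R) (two_in E) \<and>
     \<not> (\<exists>X. elts E X \<subseteq> elts E R \<and> uncountable_in E X \<and>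
            monochromatic_in E d (FS_in E R radd z X))"
proof -
  interpret model_reals E R radd rmul rle z u
    using assms by unfold_locales
  obtain Pw Lb where "model_powers E R radd rmul rle z u Pw Lb" using powers_exist by blast
  then show ?thesis by (rule model_powers.colouring_without_uncountable_monochromatic_sums)
qed

end
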